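(* Let $X$ be an infinite-dimensional separable Banach space over $\mathbb{K}\in\{\mathbb{R},\mathbb{C}\}$. Then the set of supercyclic operators in $\mathcal{L}(X)$ is spaceable, i.e. there is an infinite-dimensional closed vector subspace $V$ of $\mathcal{L}(X)$ (with the operator norm) such that every $U\in V\setminus\{0\}$ is supercyclic. Furthermore, the set of supercyclic operators in $\mathcal{L}(\ell_1)$ contains, up to the null operator, an isometric copy of $\ell_1$; i.e. there is a linear isometry $J:\ell_1\to\mathcal{L}(\ell_1)$ such that $J(\lambda)$ is supercyclic for every $\lambda\in\ell_1\setminus\{0\}$. (Here $\ell_1$ is the space of absolutely summable sequences over $\mathbb{K}$, with $\mathbb{K}=\mathbb{R}$ or $\mathbb{K}=\mathbb{C}$.)
   Context: For a Banach space $X$ over $\mathbb{K}$ ($\mathbb{K}=\mathbb{R}$ or $\mathbb{C}$), $\mathcal{L}(X)$ denotes the space of all continuous linear operators $X\to X$ with the operator norm. An operator $T\in\mathcal{L}(X)$ is supercyclic if there is a vector $x\in X$ such that $\{\lambda\,T^k(x):\lambda\in\mathbb{K},\ k\ge 0\}$ is dense in $X$. A subset of a topological vector space is called spaceable if it contains, up to the null vector, an infinite-dimensional closed vector subspace. *)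

theory Defs
  imports "HOL-Analysis.Analysis"
begin

text \<open>
  A normed space over the scalar field \<open>'k\<close> (here the reals or the complex numbers), rendered as a
  type of class \<^class>\<open>real_normed_vector\<close> with an explicit scalar multiplication extending the
  real one. Over the reals, \<open>sc\<close> is necessarily \<^const>\<open>scaleR\<close>. Completeness comes from the
  class \<^class>\<open>banach\<close>.
\<close>

locale normed_space_over = vector_space sc
  for sc :: "'k::real_normed_field \<Rightarrow> 'a::real_normed_vector \<Rightarrow> 'a" +
  assumes scale_of_real: "sc (of_real r) x = r *\<^sub>R x"
    and norm_scale: "norm (sc c x) = norm c * norm x"

lemma normed_space_over_scaleR:
  "normed_space_over (scaleR :: real \<Rightarrow> 'a::real_normed_vector \<Rightarrow> 'a)"
  by unfold_locales (simp_all add: algebra_simps)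

definition infinite_dimensional ::
    "('k::field \<Rightarrow> 'a::ab_group_add \<Rightarrow> 'a) \<Rightarrow> 'a set \<Rightarrow> bool" where
  "infinite_dimensional sc S \<longleftrightarrow> \<not> (\<exists>B. finite B \<and> S \<subseteq> module.span sc B)"

definition spaceable ::
    "('k::field \<Rightarrow> 'a::{ab_group_add, topological_space} \<Rightarrow> 'a) \<Rightarrow> 'a set \<Rightarrow> bool" where
  "spaceable sc S \<longleftrightarrow>
     (\<exists>V. module.subspace sc V \<and> closed V \<and> infinite_dimensional sc V \<and> V - {0} \<subseteq> S)"

text \<open>
  Elements of \<open>'a \<Rightarrow>\<^sub>L 'a\<close> are only real-linear, so the continuous operators over \<open>'k\<close> are those
  that in addition commute with \<open>sc\<close>. They form a closed subspace of \<open>'a \<Rightarrow>\<^sub>L 'a\<close>, whose norm is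
  the operator norm; hence closedness in either space is the same for sets of such operators.
\<close>

definition operators ::
    "('k::real_normed_field \<Rightarrow> 'a::real_normed_vector \<Rightarrow> 'a) \<Rightarrow> ('a \<Rightarrow>\<^sub>L 'a) set" where
  "operators sc = {T. Vector_Spaces.linear sc sc (blinfun_apply T)}"

definition scale_op ::
    "('k::real_normed_field \<Rightarrow> 'a::real_normed_vector \<Rightarrow> 'a) \<Rightarrow> 'k \<Rightarrow> ('a \<Rightarrow>\<^sub>L 'a) \<Rightarrow> ('a \<Rightarrow>\<^sub>L 'a)" where
  "scale_op sc c T = Blinfun (\<lambda>x. sc c (blinfun_apply T x))"

definition supercyclic ::
    "('k::real_normed_field \<Rightarrow> 'a::real_normed_vector \<Rightarrow> 'a) \<Rightarrow> ('a \<Rightarrow>\<^sub>L 'a) \<Rightarrow> bool" where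
  "supercyclic sc T \<longleftrightarrow> T \<in> operators sc \<and>
     (\<exists>x. closure {sc c ((blinfun_apply T ^^ k) x) | c k. True} = UNIV)"

context normed_space_over
begin

lemma bounded_linear_scale: "bounded_linear (sc c)"
proof (rule bounded_linear_intro[where K = "norm c"])
  show "sc c (x + y) = sc c x + sc c y" for x y
    by (rule scale_right_distrib)
  show "sc c (r *\<^sub>R x) = r *\<^sub>R sc c x" for r x
    by (metis scale_left_commute scale_of_real)
  show "norm (sc c x) \<le> norm x * norm c" for x
    by (simp add: norm_scale)
qed

lemma scale_op_apply [simp]:
  "blinfun_apply (scale_op sc c T) x = sc c (blinfun_apply T x)"
  unfolding scale_op_def
  by (subst bounded_linear_Blinfun_apply)
     (simp_all add: bounded_linear_compose[OF bounded_linear_scale blinfun.bounded_linear_right])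

lemma normed_space_over_scale_op: "normed_space_over (scale_op sc)"
proof
  fix a b :: 'k and S T :: "'a \<Rightarrow>\<^sub>L 'a" and r :: real
  show "scale_op sc a (S + T) = scale_op sc a S + scale_op sc a T"
    by (rule blinfun_eqI) (simp add: plus_blinfun.rep_eq scale_right_distrib)
  show "scale_op sc (a + b) T = scale_op sc a T + scale_op sc b T"
    by (rule blinfun_eqI) (simp add: plus_blinfun.rep_eq scale_left_distrib)
  show "scale_op sc a (scale_op sc b T) = scale_op sc (a * b) T"
    by (rule blinfun_eqI) simp
  show "scale_op sc 1 T = T"
    by (rule blinfun_eqI) simp
  show "scale_op sc (of_real r) T = r *\<^sub>R T"
    by (rule blinfun_eqI) (simp add: scale_of_real scaleR_blinfun.rep_eq)
  have le: "norm (scale_op sc c U) \<le> norm c * norm U" for c and U :: "'a \<Rightarrow>\<^sub>L 'a"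
  proof (rule norm_blinfun_bound)
    show "norm (blinfun_apply (scale_op sc c U) x) \<le> norm c * norm U * norm x" for x
      using mult_left_mono[OF norm_blinfun[of U x] norm_ge_zero[of c]]
      by (simp add: norm_scale mult.assoc)
  qed simp
  show "norm (scale_op sc a T) = norm a * norm T"
  proof (cases "a = 0")
    case True
    then show ?thesis using le[of 0 T] by simp
  next
    case False
    have "T = scale_op sc (inverse a) (scale_op sc a T)"
      by (rule blinfun_eqI) (simp add: False)
    then have "norm T \<le> norm (inverse a) * norm (scale_op sc a T)"
      using le by metis
    then have "norm a * norm T \<le> norm (scale_op sc a T)"
      using False by (simp add: norm_divide nonzero_norm_inverse inverse_eq_divide field_simps)
    then show ?thesis using le[of a T] by linarith
  qed
qed

lemma closed_operators: "closed (operators sc)"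
proof -
  have "operators sc =
      (\<Inter>c x. {T. blinfun_apply T (sc c x) = sc c (blinfun_apply T x)})" (is "_ = ?R")
  proof
    show "operators sc \<subseteq> ?R"
      by (auto simp: operators_def Vector_Spaces.linear_iff)
    show "?R \<subseteq> operators sc"
      using vector_space_axioms
      by (auto simp: operators_def Vector_Spaces.linear_iff blinfun.add_right)
  qed
  moreover have "closed {T. blinfun_apply T (sc c x) = sc c (blinfun_apply T x)}" for c x
    by (intro closed_Collect_eq continuous_intros
          bounded_linear.continuous_on[OF bounded_linear_scale])
  ultimately show ?thesis by (simp add: closed_INT)
qed

end

typedef (overloaded) 'k ell1 = "{f :: nat \<Rightarrow> 'k::real_normed_vector. summable (\<lambda>n. norm (f n))}"
  morphisms ell1_nth Abs_ell1
  by (rule exI[of _ "\<lambda>_. 0"]) simp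

setup_lifting type_definition_ell1

lemma summable_norm_ell1: "summable (\<lambda>n. norm (ell1_nth f n))"
  using ell1_nth by blast

lemma ell1_eqI: "(\<And>n. ell1_nth f n = ell1_nth g n) \<Longrightarrow> f = g"
  by (simp add: ell1_nth_inject[symmetric] fun_eq_iff)

lemma summable_norm_add:
  fixes f g :: "nat \<Rightarrow> 'k::real_normed_vector"
  assumes "summable (\<lambda>n. norm (f n))" "summable (\<lambda>n. norm (g n))"
  shows "summable (\<lambda>n. norm (f n + g n))"
  by (rule summable_comparison_test'[OF summable_add[OF assms], of 0]) (simp add: norm_triangle_ineq)

lemma summable_norm_diff:
  fixes f g :: "nat \<Rightarrow> 'k::real_normed_vector"
  assumes "summable (\<lambda>n. norm (f n))" "summable (\<lambda>n. norm (g n))"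
  shows "summable (\<lambda>n. norm (f n - g n))"
  by (rule summable_comparison_test'[OF summable_add[OF assms], of 0]) (simp add: norm_triangle_ineq4)

instantiation ell1 :: (real_normed_vector) real_normed_vector
begin

lift_definition zero_ell1 :: "'a ell1" is "\<lambda>_. 0" by simp
lift_definition plus_ell1 :: "'a ell1 \<Rightarrow> 'a ell1 \<Rightarrow> 'a ell1" is "\<lambda>f g n. f n + g n"
  by (rule summable_norm_add)
lift_definition minus_ell1 :: "'a ell1 \<Rightarrow> 'a ell1 \<Rightarrow> 'a ell1" is "\<lambda>f g n. f n - g n"
  by (rule summable_norm_diff)
lift_definition uminus_ell1 :: "'a ell1 \<Rightarrow> 'a ell1" is "\<lambda>f n. - f n" by simp
lift_definition scaleR_ell1 :: "real \<Rightarrow> 'a ell1 \<Rightarrow> 'a ell1" is "\<lambda>r f n. r *\<^sub>R f n"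
  by (simp add: summable_mult)
lift_definition norm_ell1 :: "'a ell1 \<Rightarrow> real" is "\<lambda>f. \<Sum>n. norm (f n)" .
definition sgn_ell1 :: "'a ell1 \<Rightarrow> 'a ell1" where
  "sgn_ell1 f = inverse (norm f) *\<^sub>R f"
definition dist_ell1 :: "'a ell1 \<Rightarrow> 'a ell1 \<Rightarrow> real" where "dist_ell1 f g = norm (f - g)"
definition uniformity_ell1 :: "('a ell1 \<times> 'a ell1) filter" where
  "uniformity_ell1 = (INF e\<in>{0<..}. principal {(f, g). dist f g < e})"
definition open_ell1 :: "'a ell1 set \<Rightarrow> bool" where
  "open_ell1 U \<longleftrightarrow> (\<forall>f\<in>U. eventually (\<lambda>(f', g). f' = f \<longrightarrow> g \<in> U) uniformity)"

instance
proof
  fix f g h :: "'a ell1" and r s :: real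
  show "f + g + h = f + (g + h)" by transfer (simp add: add.assoc)
  show "f + g = g + f" by transfer (simp add: add.commute)
  show "0 + f = f" by transfer simp
  show "- f + f = 0" by transfer simp
  show "f - g = f + - g" by transfer simp
  show "r *\<^sub>R (f + g) = r *\<^sub>R f + r *\<^sub>R g" by transfer (simp add: scaleR_add_right)
  show "(r + s) *\<^sub>R f = r *\<^sub>R f + s *\<^sub>R f" by transfer (simp add: scaleR_add_left)
  show "r *\<^sub>R s *\<^sub>R f = (r * s) *\<^sub>R f" by transfer simp
  show "1 *\<^sub>R f = f" by transfer simp
  show "dist f g = norm (f - g)" by (rule dist_ell1_def)
  show "sgn f = inverse (norm f) *\<^sub>R f" by (rule sgn_ell1_def)
  show "uniformity = (INF e\<in>{0<..}. principal {(f::'a ell1, g). dist f g < e})"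
    by (rule uniformity_ell1_def)
  show "open U \<longleftrightarrow> (\<forall>f\<in>U. eventually (\<lambda>(f', g). f' = f \<longrightarrow> g \<in> U) uniformity)"
    for U :: "'a ell1 set" by (rule open_ell1_def)
  show "norm f = 0 \<longleftrightarrow> f = 0"
    by transfer (auto simp: suminf_eq_zero_iff fun_eq_iff)
  show "norm (f + g) \<le> norm f + norm g"
    by transfer
       (subst suminf_add, assumption, assumption,
        rule suminf_le, auto simp: norm_triangle_ineq summable_norm_add summable_add)
  show "norm (r *\<^sub>R f) = \<bar>r\<bar> * norm f"
    by transfer (simp add: suminf_mult)
qed

end

lemma sum_norm_le_norm_ell1:
  "finite A \<Longrightarrow> (\<Sum>n\<in>A. norm (ell1_nth f n)) \<le> norm f"
  unfolding norm_ell1.rep_eq by (rule sum_le_suminf[OF summable_norm_ell1]) auto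

lemma norm_ell1_nth_le: "norm (ell1_nth f n) \<le> norm f"
  using sum_norm_le_norm_ell1[of "{n}" f] by simp

instance ell1 :: (banach) banach
proof
  fix F :: "nat \<Rightarrow> 'a ell1"
  assume "Cauchy F"
  have "Cauchy (\<lambda>k. ell1_nth (F k) n)" for n
  proof (rule metric_CauchyI)
    fix e :: real assume "e > 0"
    then obtain M where M: "\<And>i j. i \<ge> M \<Longrightarrow> j \<ge> M \<Longrightarrow> dist (F i) (F j) < e"
      using \<open>Cauchy F\<close> unfolding Cauchy_def by blast
    have "dist (ell1_nth (F i) n) (ell1_nth (F j) n) \<le> dist (F i) (F j)" for i j
      using norm_ell1_nth_le[of "F i - F j" n] by (simp add: dist_norm minus_ell1.rep_eq)
    then show "\<exists>M. \<forall>i\<ge>M. \<forall>j\<ge>M. dist (ell1_nth (F i) n) (ell1_nth (F j) n) < e"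
      using M by (meson le_less_trans)
  qed
  then have "\<forall>n. \<exists>l. (\<lambda>k. ell1_nth (F k) n) \<longlonglongrightarrow> l"
    by (simp add: Cauchy_convergent_iff convergent_def)
  then obtain g where g: "\<And>n. (\<lambda>k. ell1_nth (F k) n) \<longlonglongrightarrow> g n" by metis
  have tail: "(\<Sum>n<m. norm (ell1_nth (F i) n - g n)) \<le> e"
    if M: "\<And>i j. i \<ge> M \<Longrightarrow> j \<ge> M \<Longrightarrow> dist (F i) (F j) < e" and i: "i \<ge> M" for M e i m
  proof (rule LIMSEQ_le_const2)
    show "(\<lambda>j. \<Sum>n<m. norm (ell1_nth (F i) n - ell1_nth (F j) n))
            \<longlonglongrightarrow> (\<Sum>n<m. norm (ell1_nth (F i) n - g n))"
      by (intro tendsto_intros g)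
    have "(\<Sum>n<m. norm (ell1_nth (F i) n - ell1_nth (F j) n)) \<le> e" if "j \<ge> M" for j
      using sum_norm_le_norm_ell1[of "{..<m}" "F i - F j"] M[OF i that]
      by (simp add: dist_norm minus_ell1.rep_eq)
    then show "\<exists>N. \<forall>j\<ge>N. (\<Sum>n<m. norm (ell1_nth (F i) n - ell1_nth (F j) n)) \<le> e" by blast
  qed
  have diff: "summable (\<lambda>n. norm (ell1_nth (F i) n - g n)) \<and>
      (\<Sum>n. norm (ell1_nth (F i) n - g n)) \<le> e"
    if "\<And>i j. i \<ge> M \<Longrightarrow> j \<ge> M \<Longrightarrow> dist (F i) (F j) < e" "i \<ge> M" for M e i
  proof -
    have "summable (\<lambda>n. norm (ell1_nth (F i) n - g n))"
      using tail[OF that] by (intro summableI_nonneg_bounded[where x = e]) auto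
    then show ?thesis using tail[OF that] by (auto intro: suminf_le_const)
  qed
  obtain M where M: "\<And>i j. i \<ge> M \<Longrightarrow> j \<ge> M \<Longrightarrow> dist (F i) (F j) < 1"
    using \<open>Cauchy F\<close> unfolding Cauchy_def by (metis zero_less_one)
  have "summable (\<lambda>n. norm (ell1_nth (F M) n - (ell1_nth (F M) n - g n)))"
    by (intro summable_norm_diff summable_norm_ell1 conjunct1[OF diff[OF M order_refl]])
  then have "summable (\<lambda>n. norm (g n))" by simp
  then have G: "ell1_nth (Abs_ell1 g) = g" by (simp add: Abs_ell1_inverse)
  have "F \<longlonglongrightarrow> Abs_ell1 g"
  proof (rule metric_LIMSEQ_I)
    fix e :: real assume "e > 0"
    then obtain N where N: "\<And>i j. i \<ge> N \<Longrightarrow> j \<ge> N \<Longrightarrow> dist (F i) (F j) < e / 2"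
      using \<open>Cauchy F\<close> unfolding Cauchy_def by (metis half_gt_zero)
    have "dist (F i) (Abs_ell1 g) < e" if "i \<ge> N" for i
      using diff[OF N that] \<open>e > 0\<close>
      by (simp add: dist_norm norm_ell1.rep_eq minus_ell1.rep_eq G)
    then show "\<exists>N. \<forall>i\<ge>N. dist (F i) (Abs_ell1 g) < e" by blast
  qed
  then show "convergent F" by (rule convergentI)
qed

lift_definition scale_ell1 :: "'k::real_normed_field \<Rightarrow> 'k ell1 \<Rightarrow> 'k ell1" is "\<lambda>c f n. c * f n"
  by (simp add: norm_mult summable_mult)

lemma normed_space_over_scale_ell1:
  "normed_space_over (scale_ell1 :: 'k::real_normed_field \<Rightarrow> 'k ell1 \<Rightarrow> 'k ell1)"
proof
  fix a b :: 'k and f g :: "'k ell1" and r :: real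
  show "scale_ell1 a (f + g) = scale_ell1 a f + scale_ell1 a g"
    by transfer (simp add: algebra_simps)
  show "scale_ell1 (a + b) f = scale_ell1 a f + scale_ell1 b f"
    by transfer (simp add: algebra_simps)
  show "scale_ell1 a (scale_ell1 b f) = scale_ell1 (a * b) f"
    by transfer (simp add: algebra_simps)
  show "scale_ell1 1 f = f" by transfer simp
  show "scale_ell1 (of_real r) f = r *\<^sub>R f" by transfer (simp add: scaleR_conv_of_real)
  show "norm (scale_ell1 a f) = norm a * norm f"
    by transfer (simp add: norm_mult suminf_mult)
qed

end

theory Submission
  imports Defs
begin

text \<open>
  An operator is supercyclic as soon as its range and the union of the kernels of its powers
  contain suitable dense sets: one perturbs a vector killed by \<open>A\<^sup>n\<close> by a tiny multiple of a vector
  \<open>y\<close>, so that the \<open>n\<close>-th iterate becomes a multiple of \<open>A\<^sup>n y\<close>, and rescales; Baire's theorem turns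
  this transitivity into one vector with a dense projective orbit
  (\<open>supercyclic_if_dense_range_and_kernel\<close>).

  The backward shift \<open>B\<close> on finite sequences has both properties, and so has every nonzero formal
  power series \<open>A = a\<^sub>m B\<^sup>m + a\<^sub>m\<^sub>+\<^sub>1 B\<^sup>m\<^sup>+\<^sup>1 + ...\<close> with \<open>m \<ge> 1\<close>: it lowers degrees, and it is the
  surjective map \<open>B\<^sup>m\<close> composed with an invertible one. Thus a whole commutative algebra of
  operators, except for zero, is supercyclic. The form used, \<open>supercyclic_if_commutes_with_shift\<close>,
  is free of coefficients and speaks of operators that commute with a shift-like one and annihilate
  its kernel in a dense invariant subspace.

  On \<open>l\<^sub>1\<close> one takes \<open>J a = (\<Sum>k. a\<^sub>k B\<^sup>k\<^sup>+\<^sup>1)\<close>. Its norm is at most \<open>\<parallel>a\<parallel>\<close>, and applying it to far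
  out unit vectors, which show longer and longer segments of \<open>a\<close>, gives equality.

  On a general separable space the shift is built by hand. The Hahn-Banach theorem, in the weak
  form that functionals separate points, yields vectors \<open>x\<^sub>n\<close> with dense span and functionals \<open>f\<^sub>n\<close>
  biorthogonal to them; then \<open>T y = (\<Sum>n. w\<^sub>n f\<^sub>n\<^sub>+\<^sub>1(y) x\<^sub>n)\<close>, with rapidly decreasing weights, is
  bounded and shifts the \<open>x\<^sub>n\<close>. The operators commuting with \<open>T\<close>, annihilating \<open>x\<^sub>0\<close> and triangular
  with respect to the \<open>x\<^sub>n\<close> form a closed subspace, which contains all positive powers of \<open>T\<close> and is
  therefore infinite-dimensional.
\<close>

section \<open>Supercyclicity of operators commuting with a shift\<close>

lemma separable_space_dense_sequence:
  assumes "separable_space (euclidean :: 'a::topological_space topology)"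
  shows "\<exists>d :: nat \<Rightarrow> 'a. closure (range d) = UNIV"
proof -
  obtain C :: "'a set" where C: "countable C" "closure C = UNIV"
    using assms by (auto simp: separable_space_def)
  then have "C \<noteq> {}" by auto
  then have "range (from_nat_into C) = C" using C(1) by (rule range_from_nat_into)
  with C(2) show ?thesis by metis
qed

lemma continuous_on_funpow:
  fixes T :: "'a::real_normed_vector \<Rightarrow>\<^sub>L 'a"
  shows "continuous_on S (blinfun_apply T ^^ n)"
proof (induction n)
  case (Suc n)
  have "continuous_on S (\<lambda>x. blinfun_apply T ((blinfun_apply T ^^ n) x))"
    by (rule bounded_linear.continuous_on[OF blinfun.bounded_linear_right Suc])
  then show ?case by (simp add: comp_def)
qed (simp add: id_def)

context normed_space_over
begin

lemma continuous_on_scale: "continuous_on S f \<Longrightarrow> continuous_on S (\<lambda>x. sc c (f x))"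
  by (rule bounded_linear.continuous_on[OF bounded_linear_scale])

lemma operators_linear:
  assumes "T \<in> operators sc"
  shows "blinfun_apply T (sc c x) = sc c (blinfun_apply T x)"
  using assms by (simp add: operators_def Vector_Spaces.linear_iff)

lemma funpow_operator:
  assumes "T \<in> operators sc"
  shows funpow_operator_add: "(blinfun_apply T ^^ n) (x + y) = (blinfun_apply T ^^ n) x + (blinfun_apply T ^^ n) y"
    and funpow_operator_scale: "(blinfun_apply T ^^ n) (sc c x) = sc c ((blinfun_apply T ^^ n) x)"
    and funpow_operator_zero: "(blinfun_apply T ^^ n) 0 = 0"
  by (induction n) (simp_all add: blinfun.add_right blinfun.zero_right operators_linear[OF assms])

end

text \<open>
  Birkhoff's transitivity argument: the vectors with a multiple of some iterate in a given ball
  form an open set, dense by transitivity. By Baire's theorem countably many of these sets, one for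
  each ball of a countable family around a dense sequence, have a common point.
\<close>

lemma supercyclic_if_projectively_transitive:
  fixes sc :: "'k::real_normed_field \<Rightarrow> 'a::banach \<Rightarrow> 'a"
  assumes nso: "normed_space_over sc" and sep: "separable_space (euclidean :: 'a topology)"
    and T: "T \<in> operators sc"
    and trans: "\<And>U W. open U \<Longrightarrow> U \<noteq> {} \<Longrightarrow> open W \<Longrightarrow> W \<noteq> {} \<Longrightarrow>
       \<exists>x\<in>U. \<exists>c k. sc c ((blinfun_apply T ^^ k) x) \<in> W"
  shows "supercyclic sc T"
proof -
  interpret normed_space_over sc by (rule nso)
  obtain d :: "nat \<Rightarrow> 'a" where d: "closure (range d) = UNIV"
    using separable_space_dense_sequence[OF sep] by blast
  define G where "G = (\<lambda>(j, i). {x. \<exists>c k. sc c ((blinfun_apply T ^^ k) x) \<in> ball (d j) (1 / real (Suc i))})"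
  have "open (G p)" for p
  proof -
    obtain j i where p: "p = (j, i)" by (cases p)
    have "G p = (\<Union>c k. (\<lambda>x. sc c ((blinfun_apply T ^^ k) x)) -` ball (d j) (1 / real (Suc i)))"
      by (simp add: G_def p set_eq_iff)
    moreover have "open ((\<lambda>x. sc c ((blinfun_apply T ^^ k) x)) -` ball (d j) (1 / real (Suc i)))" for c k
      by (intro open_vimage open_ball continuous_on_scale continuous_on_funpow)
    ultimately show ?thesis by (simp only:) (intro open_UN ballI)
  qed
  moreover have "closure (G p) = UNIV" for p
  proof -
    have "G p \<inter> U \<noteq> {}" if "open U" "U \<noteq> {}" for U
      using trans[OF that, of "ball (d (fst p)) (1 / real (Suc (snd p)))"]
      by (fastforce simp: G_def split: prod.splits)
    then show ?thesis
      by (auto simp: closure_iff_nhds_not_empty) (metis empty_iff inf_commute subset_empty Int_mono order_refl)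
  qed
  ultimately have "euclidean closure_of \<Inter>(range G) = topspace (euclidean :: 'a topology)"
    using completely_metrizable_space_euclidean by (intro Baire_category) auto
  then have "closure (\<Inter>(range G)) = UNIV" by simp
  then obtain x where x: "\<And>j i. x \<in> G (j, i)"
    by (metis INT_E UNIV_I closure_empty empty_iff equals0I)
  let ?O = "{sc c ((blinfun_apply T ^^ k) x) | c k. True}"
  have "d j \<in> closure ?O" for j
    unfolding closure_approachable
  proof (intro allI impI)
    fix e :: real assume "e > 0"
    then obtain i where i: "1 / real (Suc i) < e"
      using nat_approx_posE by blast
    obtain c k where "sc c ((blinfun_apply T ^^ k) x) \<in> ball (d j) (1 / real (Suc i))"
      using x[of j i] by (auto simp: G_def)
    then show "\<exists>y\<in>?O. dist y (d j) < e"
      using i by (intro bexI[of _ "sc c ((blinfun_apply T ^^ k) x)"]) (auto simp: dist_commute)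
  qed
  then have "closure (range d) \<subseteq> closure ?O" by (intro closure_minimal) auto
  then have "closure ?O = UNIV" using d by auto
  then show ?thesis using T unfolding supercyclic_def by blast
qed

text \<open>
  A vector \<open>x\<close> with \<open>T\<^sup>n x = 0\<close> can be moved slightly to \<open>x + e y\<close>, whose \<open>n\<close>-th iterate is
  \<open>e T\<^sup>n y\<close>; after division by \<open>e\<close> this is \<open>T\<^sup>n y\<close>, an arbitrary element of \<open>E\<close>. Dividing by
  \<open>e\<close> is what supercyclicity allows and hypercyclicity does not.
\<close>

lemma supercyclic_if_dense_range_and_kernel:
  fixes sc :: "'k::real_normed_field \<Rightarrow> 'a::banach \<Rightarrow> 'a"
  assumes nso: "normed_space_over sc" and sep: "separable_space (euclidean :: 'a topology)"
    and T: "T \<in> operators sc"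
    and E: "closure E = UNIV" and nil: "\<And>x. x \<in> E \<Longrightarrow> \<exists>n. (blinfun_apply T ^^ n) x = 0"
    and surj: "E \<subseteq> blinfun_apply T ` E"
  shows "supercyclic sc T"
proof (rule supercyclic_if_projectively_transitive[OF nso sep T])
  interpret normed_space_over sc by (rule nso)
  fix U W :: "'a set" assume U: "open U" "U \<noteq> {}" and W: "open W" "W \<noteq> {}"
  have meets: "\<exists>x. x \<in> E \<inter> S" if "open S" "S \<noteq> {}" for S
    using that E open_Int_closure_eq_empty[of S E] by auto
  obtain x n where x: "x \<in> E" "x \<in> U" and n: "(blinfun_apply T ^^ n) x = 0"
    using meets[OF U] nil by blast
  obtain z where z: "z \<in> E" "z \<in> W" using meets[OF W] by blast
  have surj_pow: "\<exists>y\<in>E. (blinfun_apply T ^^ n) y = z" if "z \<in> E" for n z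
    using that
  proof (induction n arbitrary: z)
    case (Suc n)
    then obtain w where "w \<in> E" "z = blinfun_apply T w" using surj by blast
    then show ?case using Suc.IH[of w] by auto
  qed auto
  obtain y where y: "(blinfun_apply T ^^ n) y = z" using surj_pow[OF z(1)] by blast
  have "((\<lambda>e. x + e *\<^sub>R y) \<longlongrightarrow> x + 0 *\<^sub>R y) (at_right (0::real))"
    by (intro tendsto_intros)
  then have "eventually (\<lambda>e. x + e *\<^sub>R y \<in> U) (at_right (0::real))"
    using topological_tendstoD[OF _ U(1)] x by fastforce
  moreover have "eventually (\<lambda>e. e > 0) (at_right (0::real))" by (simp add: eventually_at_right_less)
  ultimately have "eventually (\<lambda>e. x + e *\<^sub>R y \<in> U \<and> e > 0) (at_right (0::real))"
    by (rule eventually_conj)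
  then have "\<exists>e. x + e *\<^sub>R y \<in> U \<and> e > 0"
    by (rule eventually_happens'[OF trivial_limit_at_right_real])
  then obtain e :: real where e: "e > 0" "x + e *\<^sub>R y \<in> U" by blast
  have "(blinfun_apply T ^^ n) (x + e *\<^sub>R y) = e *\<^sub>R z"
    using y n funpow_operator_add[OF T] funpow_operator_scale[OF T]
    by (simp flip: scale_of_real)
  then have "sc (of_real (1 / e)) ((blinfun_apply T ^^ n) (x + e *\<^sub>R y)) = z"
    using e by (simp only: scale_of_real) simp
  then show "\<exists>x\<in>U. \<exists>c k. sc c ((blinfun_apply T ^^ k) x) \<in> W"
    using e z by metis
qed

text \<open>
  Here \<open>T\<close> behaves on \<open>E\<close> like a backward shift on finite sequences, and \<open>A\<close> then acts on \<open>E\<close>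
  like a nonzero formal power series in \<open>T\<close> without constant term. Such a series lowers degrees
  and is \<open>T\<^sup>m\<close> times an invertible series, hence surjective. The proof avoids coefficients and
  works directly with the filtration of \<open>E\<close> by the kernels of the powers of \<open>T\<close>, each of which
  \<open>A\<close> maps into the preceding one.
\<close>

lemma supercyclic_if_commutes_with_shift:
  fixes sc :: "'k::real_normed_field \<Rightarrow> 'a::banach \<Rightarrow> 'a"
  assumes nso: "normed_space_over sc" and sep: "separable_space (euclidean :: 'a topology)"
    and T: "T \<in> operators sc" and A: "A \<in> operators sc"
    and E: "module.subspace sc E" "closure E = UNIV"
    and nil: "\<And>x. x \<in> E \<Longrightarrow> \<exists>n. (blinfun_apply T ^^ n) x = 0"
    and surj: "blinfun_apply T ` E = E"
    and ker: "\<And>x. x \<in> E \<Longrightarrow> blinfun_apply T x = 0 \<Longrightarrow> \<exists>c. x = sc c e"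
    and commute: "\<And>x. x \<in> E \<Longrightarrow> blinfun_apply A (blinfun_apply T x) = blinfun_apply T (blinfun_apply A x)"
    and A0: "blinfun_apply A e = 0" and inv: "blinfun_apply A ` E \<subseteq> E" and nz: "A \<noteq> 0"
  shows "supercyclic sc A"
proof (rule supercyclic_if_dense_range_and_kernel[OF nso sep A E(2)])
  interpret normed_space_over sc by (rule nso)
  let ?T = "blinfun_apply T" and ?A = "blinfun_apply A"
  have TE: "(?T ^^ n) x \<in> E" if "x \<in> E" for n x
    using that surj by (induction n) auto
  have AE: "?A x \<in> E" if "x \<in> E" for x using that inv by auto
  have commute_pow: "?A ((?T ^^ n) x) = (?T ^^ n) (?A x)" if "x \<in> E" for n x
    using that by (induction n) (simp_all add: commute TE)
  have ker_A: "?A x = 0" if "x \<in> E" "?T x = 0" for x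
    using ker[OF that] A0 by (auto simp: operators_linear[OF A])
  \<comment> \<open>If \<open>T\<^sup>n\<^sup>+\<^sup>1 x = 0\<close>, then \<open>T\<^sup>n x\<close> is in the kernel of \<open>T\<close>, which \<open>A\<close> annihilates,
    so \<open>T\<^sup>n (A x) = A (T\<^sup>n x) = 0\<close>.\<close>
  have "(?T ^^ n) x = 0 \<Longrightarrow> (?A ^^ n) x = 0" if "x \<in> E" for n x
    using that
  proof (induction n arbitrary: x)
    case (Suc n)
    have "(?T ^^ n) (?A x) = 0"
      using ker_A[OF TE[OF \<open>x \<in> E\<close>, of n]] Suc.prems commute_pow by simp
    then have "(?A ^^ n) (?A x) = 0" using Suc.IH AE Suc.prems by blast
    then show ?case by (simp add: funpow_swap1)
  qed simp
  then show "\<exists>n. (?A ^^ n) x = 0" if "x \<in> E" for x using nil that by blast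
  have "\<exists>x\<in>E. ?A x \<noteq> 0"
  proof (rule ccontr)
    assume "\<not> ?thesis"
    then have "E \<subseteq> {x. ?A x = 0}" by auto
    moreover have "closed {x. ?A x = 0}"
      by (intro closed_Collect_eq continuous_intros)
    ultimately have "closure E \<subseteq> {x. ?A x = 0}" by (rule closure_minimal)
    then show False using E(2) nz blinfun_eqI[of A 0] by (auto simp: blinfun.zero_left)
  qed
  \<comment> \<open>A vector of least degree that \<open>A\<close> does not annihilate is sent into the kernel of \<open>T\<close>, the
    line through \<open>e\<close>; so this line is in the range.\<close>
  define P where "P n \<longleftrightarrow> (\<exists>x\<in>E. (?T ^^ n) x = 0 \<and> ?A x \<noteq> 0)" for n
  have "\<exists>n. P n" using \<open>\<exists>x\<in>E. ?A x \<noteq> 0\<close> nil unfolding P_def by blast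
  define n where "n = (LEAST n. P n)"
  have "P n" unfolding n_def using \<open>\<exists>n. P n\<close> by (rule LeastI_ex)
  then obtain x where x: "x \<in> E" "(?T ^^ n) x = 0" "?A x \<noteq> 0" unfolding P_def by blast
  then obtain m where m: "n = Suc m" by (cases n) (auto simp: blinfun.zero_right)
  have "(?T ^^ m) (?T x) = 0" using x(2) by (simp add: m funpow_swap1)
  moreover have "\<not> P m" using not_less_Least[of m P] m unfolding n_def by simp
  ultimately have "?A (?T x) = 0" using TE[OF x(1), of 1] unfolding P_def by auto
  then have "?T (?A x) = 0" using commute[OF x(1)] by simp
  then obtain c where c: "?A x = sc c e" using ker AE[OF x(1)] by blast
  then have "c \<noteq> 0" using x(3) by auto
  have scale_E: "sc b y \<in> E" if "y \<in> E" for b y using E(1) that by (simp add: subspace_def)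
  have add_E: "y + z \<in> E" if "y \<in> E" "z \<in> E" for y z using E(1) that by (simp add: subspace_def)
  have ker_range: "\<exists>u\<in>E. y = ?A u" if "y \<in> E" "?T y = 0" for y
  proof -
    obtain b where b: "y = sc b e" using ker \<open>y \<in> E\<close> \<open>?T y = 0\<close> by blast
    then have "y = ?A (sc (b / c) x)" using \<open>c \<noteq> 0\<close> by (simp add: operators_linear[OF A] c)
    then show ?thesis using scale_E x(1) by blast
  qed
  \<comment> \<open>Higher degrees: if \<open>T y = A u\<close> and \<open>u = T v\<close>, then \<open>y\<close> and \<open>A v\<close> differ by an element of the
    kernel of \<open>T\<close>.\<close>
  have "\<exists>u\<in>E. y = ?A u" if "y \<in> E" "(?T ^^ k) y = 0" for k y
    using that
  proof (induction k arbitrary: y)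
    case 0
    then show ?case using ker_range[of y] by (simp add: blinfun.zero_right)
  next
    case (Suc k)
    have "(?T ^^ k) (?T y) = 0" using Suc.prems by (simp add: funpow_swap1)
    then obtain u where u: "u \<in> E" "?T y = ?A u" using Suc.IH TE[OF Suc.prems(1), of 1] by auto
    obtain v where v: "v \<in> E" "u = ?T v" using surj u(1) by blast
    have "?T (y - ?A v) = 0" using u v commute by (simp add: blinfun.diff_right)
    moreover have "y - ?A v \<in> E"
      using subspace_diff[OF E(1)] Suc.prems AE v by blast
    ultimately obtain w where w: "w \<in> E" "y - ?A v = ?A w" using ker_range by blast
    then have "y = ?A (w + v)" by (simp add: blinfun.add_right algebra_simps)
    then show ?case using add_E w v by blast
  qed
  then show "E \<subseteq> ?A ` E" using nil by blast
qed

section \<open>Power series in the backward shift on absolutely summable sequences\<close>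

lift_definition ell1_drop :: "nat \<Rightarrow> 'k::real_normed_vector ell1 \<Rightarrow> 'k ell1" is "\<lambda>k f n. f (n + k)"
  by (rule summable_ignore_initial_segment)

lemma norm_ell1_drop_le: "norm (ell1_drop k f) \<le> norm f"
  unfolding norm_ell1.rep_eq ell1_drop.rep_eq
  using suminf_split_initial_segment[OF summable_norm_ell1[of f], of k]
  by (simp add: sum_nonneg)

lift_definition backward_shift :: "nat \<Rightarrow> 'k::real_normed_vector ell1 \<Rightarrow>\<^sub>L 'k ell1" is ell1_drop
proof (rule bounded_linear_intro[where K = 1])
  fix k and x y :: "'k ell1" and r
  show "ell1_drop k (x + y) = ell1_drop k x + ell1_drop k y" by transfer simp
  show "ell1_drop k (r *\<^sub>R x) = r *\<^sub>R ell1_drop k x" by transfer simp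
  show "norm (ell1_drop k x) \<le> norm x * 1" using norm_ell1_drop_le by simp
qed

lemma backward_shift_nth [simp]: "ell1_nth (blinfun_apply (backward_shift k) f) n = ell1_nth f (n + k)"
  by (simp add: backward_shift.rep_eq ell1_drop.rep_eq)

lemma norm_backward_shift_le: "norm (backward_shift k) \<le> 1"
  by (rule norm_blinfun_bound) (simp_all add: backward_shift.rep_eq norm_ell1_drop_le)

lemma bounded_linear_ell1_nth: "bounded_linear (\<lambda>f. ell1_nth f n)"
  by (rule bounded_linear_intro[where K = 1])
     (simp_all add: plus_ell1.rep_eq scaleR_ell1.rep_eq norm_ell1_nth_le)

lift_definition ell1_of_fun :: "nat \<Rightarrow> (nat \<Rightarrow> 'k::real_normed_vector) \<Rightarrow> 'k ell1" is
  "\<lambda>N a n. if n < N then a n else 0"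
  by (rule summable_finite[of "{..<_}"]) auto

definition finite_ell1 :: "'k::real_normed_vector ell1 set" where
  "finite_ell1 = {f. \<exists>N. \<forall>n\<ge>N. ell1_nth f n = 0}"

lemma ell1_of_fun_finite: "ell1_of_fun N a \<in> finite_ell1"
  by (auto simp: finite_ell1_def ell1_of_fun.rep_eq intro!: exI[of _ N])

text \<open>
  Cut off the tail and approximate each of the remaining coordinates. With \<open>D\<close> the whole field this
  gives density of the finite sequences, with \<open>D\<close> countable it gives separability.
\<close>

lemma ell1_approximation:
  fixes f :: "'k::real_normed_vector ell1"
  assumes D: "closure D = UNIV" and e: "e > 0"
  shows "\<exists>N a. (\<forall>n<N. a n \<in> D) \<and> dist (ell1_of_fun N a) f < e"
proof -
  obtain N where "\<bar>\<Sum>n. norm (ell1_nth f (n + N))\<bar> < e / 2"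
    using suminf_exist_split[OF half_gt_zero[OF e] summable_norm_ell1[of f]]
    by (auto simp: summable_norm_ell1)
  then have N: "(\<Sum>n. norm (ell1_nth f (n + N))) < e / 2" by linarith
  have "\<exists>b\<in>D. dist b (ell1_nth f n) < e / (2 * real (Suc N))" for n
    using D e closure_approachable[of "ell1_nth f n" D] by simp
  then obtain a where a: "\<And>n. a n \<in> D" "\<And>n. dist (a n) (ell1_nth f n) < e / (2 * real (Suc N))"
    by metis
  have "norm (ell1_of_fun N a - f) = (\<Sum>n<N. norm (a n - ell1_nth f n)) + (\<Sum>n. norm (ell1_nth f (n + N)))"
    unfolding norm_ell1.rep_eq
    by (subst suminf_split_initial_segment[OF summable_norm_ell1, of _ N])
       (simp add: minus_ell1.rep_eq ell1_of_fun.rep_eq)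
  moreover have "(\<Sum>n<N. norm (a n - ell1_nth f n)) \<le> (\<Sum>n<N. e / (2 * real (Suc N)))"
    using a(2) by (intro sum_mono) (simp add: dist_norm less_imp_le)
  moreover have "(\<Sum>n<N. e / (2 * real (Suc N))) \<le> e / 2"
    using e by (simp add: field_simps)
  ultimately have "dist (ell1_of_fun N a) f < e" using N unfolding dist_norm by linarith
  then show ?thesis using a(1) by blast
qed

lemma closure_finite_ell1: "closure finite_ell1 = (UNIV :: 'k::real_normed_vector ell1 set)"
  using ell1_approximation[of "UNIV :: 'k set"] ell1_of_fun_finite
  by (fastforce simp: closure_approachable set_eq_iff)

lemma separable_space_ell1:
  "separable_space (euclidean :: 'k::{real_normed_vector, second_countable_topology} ell1 topology)"
proof -
  obtain D :: "'k set" where D: "countable D" "\<And>X. open X \<Longrightarrow> X \<noteq> {} \<Longrightarrow> \<exists>d\<in>D. d \<in> X"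
    using countable_dense_setE by blast
  have cD: "closure D = UNIV"
  proof -
    have "interior (- D) = {}" using D(2)[of "interior (- D)"] interior_subset[of "- D"] by auto
    then show ?thesis by (auto simp: interior_complement)
  qed
  define C where "C = (\<Union>N. (\<lambda>l. ell1_of_fun N (\<lambda>n. l ! n)) ` lists D)"
  have "countable C" unfolding C_def using D(1) by (intro countable_UN countable_image countable_lists) auto
  moreover have "closure C = UNIV"
  proof -
    have "\<exists>g\<in>C. dist g f < e" if e: "e > 0" for f and e :: real
    proof -
      obtain N a where a: "\<forall>n<N. a n \<in> D" "dist (ell1_of_fun N a) f < e"
        using ell1_approximation[OF cD e] by blast
      have "ell1_of_fun N a = ell1_of_fun N (\<lambda>n. map a [0..<N] ! n)"
        by (rule ell1_eqI) (simp add: ell1_of_fun.rep_eq)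
      moreover have "map a [0..<N] \<in> lists D" using a(1) by auto
      ultimately have "ell1_of_fun N a \<in> C" unfolding C_def by blast
      then show ?thesis using a(2) by blast
    qed
    then show ?thesis by (auto simp: closure_approachable set_eq_iff)
  qed
  ultimately show ?thesis unfolding separable_space_def by auto
qed

text \<open>
  The series starts with the first power of the shift, not with the identity, so that it lowers
  degrees and is locally nilpotent on finite sequences.
\<close>

definition shift_series :: "'k::{real_normed_field, banach} ell1 \<Rightarrow> 'k ell1 \<Rightarrow>\<^sub>L 'k ell1" where
  "shift_series a = (\<Sum>k. scale_op scale_ell1 (ell1_nth a k) (backward_shift (Suc k)))"

context
begin

interpretation ell1: normed_space_over "scale_ell1 :: 'k::{real_normed_field, banach} \<Rightarrow> 'k ell1 \<Rightarrow> 'k ell1"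
  by (rule normed_space_over_scale_ell1)
interpretation ell1_op: normed_space_over
  "scale_op scale_ell1 :: 'k::{real_normed_field, banach} \<Rightarrow> ('k ell1 \<Rightarrow>\<^sub>L 'k ell1) \<Rightarrow> _"
  by (rule ell1.normed_space_over_scale_op)

lemma shift_series_term_le:
  fixes a :: "'k::{real_normed_field, banach} ell1"
  shows "norm (scale_op scale_ell1 (ell1_nth a k) (backward_shift (Suc k))) \<le> norm (ell1_nth a k)"
  using mult_left_mono[OF norm_backward_shift_le, of "norm (ell1_nth a k)"]
  by (simp add: ell1_op.norm_scale)

lemma summable_norm_shift_series:
  fixes a :: "'k::{real_normed_field, banach} ell1"
  shows "summable (\<lambda>k. norm (scale_op scale_ell1 (ell1_nth a k) (backward_shift (Suc k))))"
  by (rule summable_comparison_test'[OF summable_norm_ell1[of a], of 0])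
     (simp add: shift_series_term_le)

lemmas summable_shift_series = summable_norm_cancel[OF summable_norm_shift_series]

lemma shift_series_nth_sums:
  fixes a :: "'k::{real_normed_field, banach} ell1"
  shows "(\<lambda>k. ell1_nth a k * ell1_nth f (n + Suc k)) sums ell1_nth (blinfun_apply (shift_series a) f) n"
proof -
  have "bounded_linear (\<lambda>T :: 'k ell1 \<Rightarrow>\<^sub>L 'k ell1. ell1_nth (blinfun_apply T f) n)"
    by (rule bounded_linear_compose[OF bounded_linear_ell1_nth blinfun.bounded_linear_left])
  from bounded_linear.sums[OF this summable_sums[OF summable_shift_series[of a]]]
  show ?thesis by (simp add: shift_series_def scale_ell1.rep_eq)
qed

lemma shift_series_nth:
  fixes a :: "'k::{real_normed_field, banach} ell1"
  shows "ell1_nth (blinfun_apply (shift_series a) f) n = (\<Sum>k. ell1_nth a k * ell1_nth f (n + Suc k))"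
  using shift_series_nth_sums by (rule sums_unique)

lemma shift_series_operator:
  fixes a :: "'k::{real_normed_field, banach} ell1"
  shows "shift_series a \<in> operators scale_ell1"
proof -
  have "blinfun_apply (shift_series a) (scale_ell1 c f) = scale_ell1 c (blinfun_apply (shift_series a) f)" for c f
    using sums_mult[OF shift_series_nth_sums[of a f], of c]
    by (intro ell1_eqI) (simp add: shift_series_nth scale_ell1.rep_eq algebra_simps sums_unique[symmetric])
  then show ?thesis
    by (simp add: operators_def Vector_Spaces.linear_iff blinfun.add_right ell1.vector_space_axioms)
qed

lemma linear_shift_series:
  "Vector_Spaces.linear scale_ell1 (scale_op scale_ell1)
     (shift_series :: 'k::{real_normed_field, banach} ell1 \<Rightarrow> _)"
proof -
  have "shift_series (a + b) = shift_series a + shift_series b" for a b :: "'k ell1"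
    using sums_add[OF shift_series_nth_sums[of a] shift_series_nth_sums[of b]]
    by (intro blinfun_eqI ell1_eqI)
       (simp add: shift_series_nth plus_ell1.rep_eq blinfun.add_left algebra_simps sums_unique[symmetric])
  moreover have "shift_series (scale_ell1 c a) = scale_op scale_ell1 c (shift_series a)" for c and a :: "'k ell1"
    using sums_mult[OF shift_series_nth_sums[of a], of c]
    by (intro blinfun_eqI ell1_eqI)
       (simp add: shift_series_nth scale_ell1.rep_eq algebra_simps sums_unique[symmetric])
  ultimately show ?thesis
    by (simp add: Vector_Spaces.linear_iff ell1.vector_space_axioms ell1_op.vector_space_axioms)
qed

text \<open>
  The powers of the shift have norm at most one, which gives the upper bound. For the lower bound,
  the image of the \<open>N\<close>-th unit vector has the first \<open>N\<close> coefficients of \<open>a\<close> as its coordinates, in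
  reverse order.
\<close>

lemma norm_shift_series:
  fixes a :: "'k::{real_normed_field, banach} ell1"
  shows "norm (shift_series a) = norm a"
proof (rule antisym)
  have "norm (shift_series a) \<le> (\<Sum>k. norm (scale_op scale_ell1 (ell1_nth a k) (backward_shift (Suc k))))"
    unfolding shift_series_def by (rule summable_norm[OF summable_norm_shift_series])
  also have "\<dots> \<le> norm a"
    unfolding norm_ell1.rep_eq
    by (intro suminf_le shift_series_term_le summable_norm_shift_series summable_norm_ell1)
  finally show "norm (shift_series a) \<le> norm a" .
next
  have "(\<Sum>k<N. norm (ell1_nth a k)) \<le> norm (shift_series a)" for N
  proof -
    define e :: "'k ell1" where "e = ell1_of_fun (Suc N) (\<lambda>n. if n = N then 1 else 0)"
    have e_nth: "ell1_nth e n = (if n = N then 1 else 0)" for n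
      by (simp add: e_def ell1_of_fun.rep_eq)
    have "norm e = 1"
      unfolding norm_ell1.rep_eq using sums_single[of N "\<lambda>_. 1 :: real"]
      by (simp add: e_nth if_distrib sums_unique[symmetric] cong: if_cong)
    have nth: "ell1_nth (blinfun_apply (shift_series a) e) n = ell1_nth a (N - Suc n)" if "n < N" for n
    proof -
      have "ell1_nth a k * ell1_nth e (n + Suc k) = (if k = N - Suc n then ell1_nth a k else 0)" for k
        using that by (auto simp: e_nth)
      then show ?thesis
        using sums_single[of "N - Suc n" "ell1_nth a"] shift_series_nth_sums[of a e n] sums_unique2
        by simp
    qed
    have "(\<Sum>k<N. norm (ell1_nth a k)) = (\<Sum>n<N. norm (ell1_nth a (N - Suc n)))"
      by (rule sum.nat_diff_reindex[symmetric])
    also have "\<dots> = (\<Sum>n<N. norm (ell1_nth (blinfun_apply (shift_series a) e) n))"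
      by (simp add: nth)
    also have "\<dots> \<le> norm (blinfun_apply (shift_series a) e)" by (rule sum_norm_le_norm_ell1) simp
    also have "\<dots> \<le> norm (shift_series a)" using norm_blinfun[of "shift_series a" e] \<open>norm e = 1\<close> by simp
    finally show ?thesis .
  qed
  then show "norm a \<le> norm (shift_series a)"
    unfolding norm_ell1.rep_eq[of a] by (intro suminf_le_const summable_norm_ell1)
qed

lemma supercyclic_shift_series:
  fixes a :: "'k::{real_normed_field, banach, second_countable_topology} ell1"
  assumes "a \<noteq> 0"
  shows "supercyclic scale_ell1 (shift_series a)"
proof (rule supercyclic_if_commutes_with_shift[where T = "backward_shift 1" and E = finite_ell1
      and e = "ell1_of_fun 1 (\<lambda>_. 1)"])
  let ?B = "blinfun_apply (backward_shift 1 :: 'k ell1 \<Rightarrow>\<^sub>L _)"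
  show "normed_space_over (scale_ell1 :: 'k \<Rightarrow> _)" by (rule normed_space_over_scale_ell1)
  show "separable_space (euclidean :: 'k ell1 topology)" by (rule separable_space_ell1)
  show "backward_shift 1 \<in> operators (scale_ell1 :: 'k \<Rightarrow> _)"
    by (auto simp: operators_def Vector_Spaces.linear_iff blinfun.add_right ell1.vector_space_axioms
        scale_ell1.rep_eq intro!: ell1_eqI)
  show "shift_series a \<in> operators scale_ell1" by (rule shift_series_operator)
  show "module.subspace scale_ell1 (finite_ell1 :: 'k ell1 set)"
  proof (rule ell1.subspaceI)
    fix x y :: "'k ell1" assume "x \<in> finite_ell1" "y \<in> finite_ell1"
    then obtain M N where "\<forall>n\<ge>M. ell1_nth x n = 0" "\<forall>n\<ge>N. ell1_nth y n = 0"
      unfolding finite_ell1_def by blast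
    then show "x + y \<in> finite_ell1"
      by (auto simp: finite_ell1_def plus_ell1.rep_eq intro!: exI[of _ "max M N"])
  qed (auto simp: finite_ell1_def zero_ell1.rep_eq scale_ell1.rep_eq)
  show "closure finite_ell1 = (UNIV :: 'k ell1 set)" by (rule closure_finite_ell1)
  have B_pow: "ell1_nth ((?B ^^ N) x) n = ell1_nth x (n + N)" for N n x
    by (induction N arbitrary: n) simp_all
  show "\<exists>n. (?B ^^ n) x = 0" if x: "x \<in> finite_ell1" for x
  proof -
    obtain N where "\<forall>n\<ge>N. ell1_nth x n = 0" using x by (auto simp: finite_ell1_def)
    then have "(?B ^^ N) x = 0" by (intro ell1_eqI) (use B_pow in \<open>simp add: zero_ell1.rep_eq\<close>)
    then show ?thesis ..
  qed
  show "?B ` finite_ell1 = finite_ell1"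
  proof (intro equalityI subsetI)
    fix x :: "'k ell1" assume "x \<in> finite_ell1"
    then obtain N where N: "\<forall>n\<ge>N. ell1_nth x n = 0" by (auto simp: finite_ell1_def)
    let ?y = "ell1_of_fun (Suc N) (\<lambda>n. ell1_nth x (n - 1))"
    have "x = ?B ?y" using N by (intro ell1_eqI) (simp add: ell1_of_fun.rep_eq)
    then show "x \<in> ?B ` finite_ell1" using ell1_of_fun_finite by blast
  next
    fix y :: "'k ell1" assume "y \<in> ?B ` finite_ell1"
    then obtain x N where "y = ?B x" "\<forall>n\<ge>N. ell1_nth x n = 0" by (auto simp: finite_ell1_def)
    then have "\<forall>n\<ge>N. ell1_nth y n = 0" by simp
    then show "y \<in> finite_ell1" unfolding finite_ell1_def by blast
  qed
  show "\<exists>c. x = scale_ell1 c (ell1_of_fun 1 (\<lambda>_. 1))" if "?B x = 0" for x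
  proof -
    have "ell1_nth x (Suc n) = 0" for n
      using arg_cong[OF that, of "\<lambda>y. ell1_nth y n"] by (simp add: zero_ell1.rep_eq)
    then have "ell1_nth x n = 0" if "n > 0" for n using that by (cases n) auto
    then have "x = scale_ell1 (ell1_nth x 0) (ell1_of_fun 1 (\<lambda>_. 1))"
      by (intro ell1_eqI) (auto simp: scale_ell1.rep_eq ell1_of_fun.rep_eq)
    then show ?thesis ..
  qed
  show "blinfun_apply (shift_series a) (?B x) = ?B (blinfun_apply (shift_series a) x)" for x
    by (rule ell1_eqI) (simp add: shift_series_nth)
  show "blinfun_apply (shift_series a) (ell1_of_fun 1 (\<lambda>_. 1)) = 0"
    by (rule ell1_eqI) (simp add: shift_series_nth ell1_of_fun.rep_eq zero_ell1.rep_eq)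
  show "blinfun_apply (shift_series a) ` finite_ell1 \<subseteq> finite_ell1"
  proof safe
    fix x :: "'k ell1" assume "x \<in> finite_ell1"
    then obtain N where N: "\<forall>n\<ge>N. ell1_nth x n = 0" by (auto simp: finite_ell1_def)
    then have "\<forall>n\<ge>N. ell1_nth (blinfun_apply (shift_series a) x) n = 0"
      by (simp add: shift_series_nth)
    then show "blinfun_apply (shift_series a) x \<in> finite_ell1" unfolding finite_ell1_def by blast
  qed
  show "shift_series a \<noteq> 0" using assms norm_shift_series[of a] by auto
qed

end

section \<open>Bounded functionals separate points\<close>

definition sublinear :: "('a::real_vector \<Rightarrow> real) \<Rightarrow> bool" where
  "sublinear p \<longleftrightarrow> (\<forall>x y. p (x + y) \<le> p x + p y) \<and> (\<forall>r>0. \<forall>x. p (r *\<^sub>R x) = r * p x)"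

lemma sublinear_0:
  assumes "sublinear p"
  shows "p 0 = 0"
proof -
  have "p 0 = 2 * p 0"
    using assms[unfolded sublinear_def, THEN conjunct2, rule_format, of 2 0] by simp
  then show ?thesis by simp
qed

lemma sublinear_scale:
  assumes "sublinear p" "t \<ge> 0"
  shows "p (t *\<^sub>R x) = t * p x"
  using assms sublinear_0[OF assms(1)] unfolding sublinear_def by (cases "t = 0") auto

lemma sublinear_lower:
  assumes "sublinear p"
  shows "- p (- x) \<le> p x"
proof -
  have "p (x + - x) \<le> p x + p (- x)"
    using assms unfolding sublinear_def by blast
  then show ?thesis using sublinear_0[OF assms] by simp
qed

text \<open>
  The largest sublinear function \<open>h \<le> p\<close> with \<open>h (- z) \<le> - p z\<close>, that is, one that is additive
  on the line through \<open>z\<close>. It serves twice: to force a nonzero value at a given point, and to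
  show that a minimal sublinear function has no room left below it and so is additive everywhere.
\<close>

definition tilt :: "('a::real_vector \<Rightarrow> real) \<Rightarrow> 'a \<Rightarrow> 'a \<Rightarrow> real" where
  "tilt p z y = (INF t\<in>{0..}. p (y + t *\<^sub>R z) - t * p z)"

lemma tilt_le:
  assumes "sublinear p" "t \<ge> 0"
  shows "tilt p z y \<le> p (y + t *\<^sub>R z) - t * p z"
  unfolding tilt_def
proof (rule cINF_lower)
  have "- p (- y) \<le> p (y + s *\<^sub>R z) - s * p z" if "s \<ge> 0" for s
  proof -
    have "p ((y + s *\<^sub>R z) + - y) \<le> p (y + s *\<^sub>R z) + p (- y)"
      using assms unfolding sublinear_def by blast
    then show ?thesis using sublinear_scale[OF assms(1) that, of z] by simp
  qed
  then show "bdd_below ((\<lambda>t. p (y + t *\<^sub>R z) - t * p z) ` {0..})"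
    by (intro bdd_belowI2[where m = "- p (- y)"]) auto
qed (use assms in auto)

lemma tilt_greatest:
  assumes "\<And>t. t \<ge> 0 \<Longrightarrow> c \<le> p (y + t *\<^sub>R z) - t * p z"
  shows "c \<le> tilt p z y"
  unfolding tilt_def using assms by (intro cINF_greatest) auto

lemma sublinear_tilt:
  assumes p: "sublinear p"
  shows "sublinear (tilt p z)"
proof -
  have scale: "r * tilt p z x \<le> tilt p z (r *\<^sub>R x)" if r: "r > 0" for r x
  proof (rule tilt_greatest)
    fix t :: real assume t: "t \<ge> 0"
    have "p (r *\<^sub>R x + t *\<^sub>R z) = p (r *\<^sub>R (x + (t / r) *\<^sub>R z))"
      using r by (simp add: scaleR_add_right)
    also have "\<dots> = r * p (x + (t / r) *\<^sub>R z)" using p r unfolding sublinear_def by blast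
    finally have "p (r *\<^sub>R x + t *\<^sub>R z) - t * p z = r * (p (x + (t / r) *\<^sub>R z) - (t / r) * p z)"
      using r by (simp add: right_diff_distrib)
    moreover have "r * tilt p z x \<le> r * (p (x + (t / r) *\<^sub>R z) - (t / r) * p z)"
      using r t by (intro mult_left_mono tilt_le[OF p]) auto
    ultimately show "r * tilt p z x \<le> p (r *\<^sub>R x + t *\<^sub>R z) - t * p z" by simp
  qed
  have "tilt p z (r *\<^sub>R x) = r * tilt p z x" if r: "r > 0" for r x
  proof (rule antisym)
    have "(1 / r) * tilt p z (r *\<^sub>R x) \<le> tilt p z ((1 / r) *\<^sub>R r *\<^sub>R x)"
      using r by (intro scale) simp
    then show "tilt p z (r *\<^sub>R x) \<le> r * tilt p z x" using r by (simp add: field_simps)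
  qed (rule scale[OF r])
  moreover have "tilt p z (x + y) \<le> tilt p z x + tilt p z y" for x y
  proof -
    have "tilt p z (x + y) - (p (x + s *\<^sub>R z) - s * p z) \<le> tilt p z y" if s: "s \<ge> 0" for s
    proof (rule tilt_greatest)
      fix t :: real assume t: "t \<ge> 0"
      have "tilt p z (x + y) \<le> p ((x + y) + (s + t) *\<^sub>R z) - (s + t) * p z"
        using s t by (intro tilt_le[OF p]) auto
      also have "p ((x + y) + (s + t) *\<^sub>R z) = p ((x + s *\<^sub>R z) + (y + t *\<^sub>R z))"
        by (simp add: algebra_simps)
      also have "\<dots> \<le> p (x + s *\<^sub>R z) + p (y + t *\<^sub>R z)" using p unfolding sublinear_def by blast
      finally show "tilt p z (x + y) - (p (x + s *\<^sub>R z) - s * p z) \<le> p (y + t *\<^sub>R z) - t * p z"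
        by (simp add: algebra_simps)
    qed
    then have "tilt p z (x + y) - tilt p z y \<le> tilt p z x"
      by (intro tilt_greatest) (smt (verit))
    then show ?thesis by simp
  qed
  ultimately show ?thesis unfolding sublinear_def by blast
qed

text \<open>
  Zorn's lemma, ordering the sublinear functions below \<open>q\<close> downwards. The pointwise infimum of a
  chain is finite since \<open>- q (- y) \<le> - p (- y) \<le> p y\<close> bounds all its members from below.
\<close>

lemma exists_minimal_sublinear:
  fixes q :: "'a::real_vector \<Rightarrow> real"
  assumes q: "sublinear q"
  shows "\<exists>p. sublinear p \<and> p \<le> q \<and> (\<forall>p'. sublinear p' \<longrightarrow> p' \<le> p \<longrightarrow> p' = p)"
proof -
  define \<A> where "\<A> = {p. sublinear p \<and> p \<le> q}"
  have "\<exists>m\<in>\<A>. \<forall>a\<in>\<A>. a \<le> m \<longrightarrow> a = m"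
  proof (rule predicate_Zorn[where P = "(\<ge>)"])
    show "partial_order_on \<A> (relation_of (\<ge>) \<A>)"
      by (rule partial_order_on_relation_ofI) auto
  next
    fix C assume C: "C \<in> Chains (relation_of (\<ge>) \<A>)"
    then have CA: "C \<subseteq> \<A>" and lin: "\<And>a b. a \<in> C \<Longrightarrow> b \<in> C \<Longrightarrow> a \<le> b \<or> b \<le> a"
      by (auto simp: Chains_def relation_of_def)
    show "\<exists>u\<in>\<A>. \<forall>a\<in>C. u \<le> a"
    proof (cases "C = {}")
      case True
      then show ?thesis using q by (auto simp: \<A>_def)
    next
      case False
      define u where "u y = (INF p\<in>C. p y)" for y
      have u_le: "u y \<le> p y" if "p \<in> C" for p y
        unfolding u_def
      proof (rule cINF_lower[OF _ that])
        have "- q (- y) \<le> p y" if "p \<in> C" for p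
        proof -
          have "- p (- y) \<le> p y" "p (- y) \<le> q (- y)"
            using that CA sublinear_lower[of p y] by (auto simp: \<A>_def le_fun_def)
          then show ?thesis by linarith
        qed
        then show "bdd_below ((\<lambda>p. p y) ` C)" by (intro bdd_belowI2)
      qed
      have u_ge: "c \<le> u y" if "\<And>p. p \<in> C \<Longrightarrow> c \<le> p y" for c y
        unfolding u_def using False that by (intro cINF_greatest) auto
      have sub: "sublinear p" if "p \<in> C" for p using that CA by (auto simp: \<A>_def)
      have "u (x + y) \<le> u x + u y" for x y
      proof -
        \<comment> \<open>the smaller of the two members of the chain bounds both sides\<close>
        have "u (x + y) \<le> p x + p' y" if pp': "p \<in> C" "p' \<in> C" for p p'
        proof -
          obtain r where r: "r \<in> C" "r \<le> p" "r \<le> p'" using lin[OF pp'] pp' by blast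
          have "u (x + y) \<le> r x + r y"
            using u_le[OF r(1), of "x + y"] sub[OF r(1)] unfolding sublinear_def by (meson order_trans)
          also have "\<dots> \<le> p x + p' y" using r by (intro add_mono) (auto simp: le_fun_def)
          finally show ?thesis .
        qed
        then have "u (x + y) - p x \<le> u y" if "p \<in> C" for p
          using that by (intro u_ge) (smt (verit))
        then have "u (x + y) - u y \<le> u x" by (intro u_ge) (smt (verit))
        then show ?thesis by simp
      qed
      moreover have "u (r *\<^sub>R x) = r * u x" if r: "r > 0" for r x
      proof (rule antisym)
        have "u (r *\<^sub>R x) / r \<le> u x"
        proof (rule u_ge)
          fix p assume "p \<in> C"
          then show "u (r *\<^sub>R x) / r \<le> p x"
            using u_le[of p "r *\<^sub>R x"] sub[of p] r unfolding sublinear_def by (simp add: field_simps)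
        qed
        then show "u (r *\<^sub>R x) \<le> r * u x" using r by (simp add: field_simps)
        show "r * u x \<le> u (r *\<^sub>R x)"
        proof (rule u_ge)
          fix p assume "p \<in> C"
          then show "r * u x \<le> p (r *\<^sub>R x)"
            using u_le[of p x] sub[of p] r unfolding sublinear_def by simp
        qed
      qed
      moreover have "u \<le> q"
        using False CA u_le unfolding \<A>_def le_fun_def by (blast intro: order_trans)
      ultimately have "u \<in> \<A>" unfolding \<A>_def sublinear_def by blast
      then show ?thesis using u_le by (auto simp: le_fun_def)
    qed
  qed
  then obtain m where "m \<in> \<A>" "\<And>a. a \<in> \<A> \<Longrightarrow> a \<le> m \<Longrightarrow> a = m" by blast
  then show ?thesis unfolding \<A>_def by (intro exI[of _ m]) auto
qed

text \<open>
  Minimality gives \<open>tilt p y = p\<close>, and evaluating the infimum at \<open>t = 1\<close> yields the missing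
  inequality \<open>p x + p y \<le> p (x + y)\<close>.
\<close>

lemma linear_minimal_sublinear:
  assumes p: "sublinear p" and min: "\<And>p'. sublinear p' \<Longrightarrow> p' \<le> p \<Longrightarrow> p' = p"
  shows "linear p"
proof -
  have add: "p (x + y) = p x + p y" for x y
  proof (rule antisym)
    have "tilt p y = p"
      using tilt_le[OF p, of 0 y] by (intro min sublinear_tilt[OF p]) (auto simp: le_fun_def)
    then show "p x + p y \<le> p (x + y)" using tilt_le[OF p, of 1 y x] by simp
  qed (use p in \<open>auto simp: sublinear_def\<close>)
  have neg: "p (- x) = - p x" for x using add[of x "- x"] sublinear_0[OF p] by simp
  show ?thesis
  proof (rule linearI)
    show "p (x + y) = p x + p y" for x y by (rule add)
    fix r x
    show "p (r *\<^sub>R x) = r *\<^sub>R p x"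
    proof (cases "r \<ge> 0")
      case True
      then show ?thesis using sublinear_scale[OF p] by simp
    next
      case False
      then show ?thesis using sublinear_scale[OF p, of "- r" x] neg[of "r *\<^sub>R x"] by simp
    qed
  qed
qed

text \<open>
  Any linear \<open>p \<le> tilt norm z\<close> is bounded by the norm and has \<open>p (- z) \<le> - norm z\<close>, hence
  \<open>p z \<ge> norm z > 0\<close>.
\<close>

lemma exists_separating_functional:
  fixes z :: "'a::real_normed_vector"
  assumes "z \<noteq> 0"
  shows "\<exists>g. bounded_linear g \<and> g z \<noteq> (0::real)"
proof -
  have N: "sublinear (norm :: 'a \<Rightarrow> real)"
    by (auto simp: sublinear_def norm_triangle_ineq)
  obtain p where p: "sublinear p" and le: "p \<le> tilt norm z"
    and min: "\<And>p'. sublinear p' \<Longrightarrow> p' \<le> p \<Longrightarrow> p' = p"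
    using exists_minimal_sublinear[OF sublinear_tilt[OF N, of z]] by blast
  have lin: "linear p" using linear_minimal_sublinear[OF p] min by blast
  have bound: "p y \<le> norm y" for y
    using le tilt_le[OF N, of 0 z y] by (auto simp: le_fun_def intro: order_trans)
  have "p (- z) \<le> - norm z"
    using le tilt_le[OF N, of 1 z "- z"] by (auto simp: le_fun_def intro: order_trans)
  then have "p z \<noteq> 0" using assms linear_neg[OF lin, of z] by (auto simp: not_le)
  moreover have "bounded_linear p"
  proof (rule bounded_linear_intro[where K = 1])
    show "norm (p y) \<le> norm y * 1" for y
      using bound[of y] bound[of "- y"] linear_neg[OF lin, of y] by (simp add: abs_le_iff)
  qed (use lin in \<open>auto simp: linear_add linear_scale\<close>)
  ultimately show ?thesis by blast
qed

section \<open>Biorthogonal systems in separable spaces\<close>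

context normed_space_over
begin

lemma bounded_linear_scale_left: "bounded_linear (\<lambda>c. sc c x)"
proof (rule bounded_linear_intro[where K = "norm x"])
  show "sc (r *\<^sub>R c) x = r *\<^sub>R sc c x" for r c
    by (simp add: scaleR_conv_of_real scale_of_real flip: scale_scale)
qed (simp_all add: scale_left_distrib norm_scale)

text \<open>
  The elements of the dual space over the scalar field of \<open>sc\<close>; without the second condition they
  would be linear over the reals only.
\<close>

definition functional :: "('a \<Rightarrow> 'k) \<Rightarrow> bool" where
  "functional f \<longleftrightarrow> bounded_linear f \<and> (\<forall>c x. f (sc c x) = c * f x)"

lemma functional_scale: "functional f \<Longrightarrow> f (sc c x) = c * f x"
  and functional_zero: "functional f \<Longrightarrow> f 0 = 0"
  and functional_diff: "functional f \<Longrightarrow> f (x - y) = f x - f y"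
  and functional_sum: "functional f \<Longrightarrow> f (sum g I) = (\<Sum>i\<in>I. f (g i))"
  unfolding functional_def
  by (auto simp: bounded_linear.linear linear_diff linear_0 linear_sum)

lemma bounded_linear_rank_one:
  assumes "functional f" shows "bounded_linear (\<lambda>y. sc (f y) x)"
  using assms bounded_linear_compose[OF bounded_linear_scale_left] unfolding functional_def by blast

definition biorthogonal :: "nat \<Rightarrow> (nat \<Rightarrow> 'a) \<Rightarrow> (nat \<Rightarrow> 'a \<Rightarrow> 'k) \<Rightarrow> bool" where
  "biorthogonal n x f \<longleftrightarrow>
     (\<forall>i<n. functional (f i)) \<and> (\<forall>i<n. \<forall>j<n. f i (x j) = (if i = j then 1 else 0))"

lemma biorthogonal_coeff:
  assumes "biorthogonal n x f" "j < n"
  shows "f j (\<Sum>i<n. sc (c i) (x i)) = c j"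
proof -
  have f: "functional (f j)" using assms by (simp add: biorthogonal_def)
  have "f j (\<Sum>i<n. sc (c i) (x i)) = (\<Sum>i<n. c i * f j (x i))"
    by (simp add: functional_sum[OF f] functional_scale[OF f])
  also have "\<dots> = (\<Sum>i<n. if i = j then c i else 0)"
    using assms by (intro sum.cong) (auto simp: biorthogonal_def)
  finally have "f j (\<Sum>i<n. sc (c i) (x i)) = (\<Sum>i<n. if i = j then c i else 0)" .
  then show ?thesis using assms(2) by simp
qed

lemma biorthogonal_span_iff:
  assumes b: "biorthogonal n x f"
  shows "y \<in> span (x ` {..<n}) \<longleftrightarrow> y = (\<Sum>i<n. sc (f i y) (x i))"
proof
  assume "y \<in> span (x ` {..<n})"
  also have "span (x ` {..<n}) \<subseteq> range (\<lambda>c. \<Sum>i<n. sc (c i) (x i))"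
  proof (rule span_minimal)
    show "subspace (range (\<lambda>c. \<Sum>i<n. sc (c i) (x i)))"
    proof (rule subspaceI)
      fix a b assume "a \<in> range (\<lambda>c. \<Sum>i<n. sc (c i) (x i))" "b \<in> range (\<lambda>c. \<Sum>i<n. sc (c i) (x i))"
      then obtain c d where "a = (\<Sum>i<n. sc (c i) (x i))" "b = (\<Sum>i<n. sc (d i) (x i))" by blast
      then have "a + b = (\<Sum>i<n. sc (c i + d i) (x i))" by (simp add: scale_left_distrib sum.distrib)
      then show "a + b \<in> range (\<lambda>c. \<Sum>i<n. sc (c i) (x i))"
        by (intro image_eqI[of _ _ "\<lambda>i. c i + d i"]) auto
    next
      fix r a assume "a \<in> range (\<lambda>c. \<Sum>i<n. sc (c i) (x i))"
      then obtain c where "a = (\<Sum>i<n. sc (c i) (x i))" by blast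
      then have "sc r a = (\<Sum>i<n. sc (r * c i) (x i))" by (simp add: scale_sum_right)
      then show "sc r a \<in> range (\<lambda>c. \<Sum>i<n. sc (c i) (x i))"
        by (intro image_eqI[of _ _ "\<lambda>i. r * c i"]) auto
    next
      have "0 = (\<Sum>i<n. sc 0 (x i))" by simp
      then show "0 \<in> range (\<lambda>c. \<Sum>i<n. sc (c i) (x i))"
        by (intro image_eqI[of _ _ "\<lambda>i. 0"]) auto
    qed
    show "x ` {..<n} \<subseteq> range (\<lambda>c. \<Sum>i<n. sc (c i) (x i))"
    proof
      fix y assume "y \<in> x ` {..<n}"
      then obtain j where j: "j < n" "y = x j" by blast
      have "y = (\<Sum>i<n. if i = j then x i else 0)" using j by simp
      also have "\<dots> = (\<Sum>i<n. sc (if i = j then 1 else 0) (x i))" by (intro sum.cong) auto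
      finally show "y \<in> range (\<lambda>c. \<Sum>i<n. sc (c i) (x i))"
        by (intro image_eqI[of _ _ "\<lambda>i. if i = j then 1 else 0"]) auto
    qed
  qed
  finally obtain c where "y = (\<Sum>i<n. sc (c i) (x i))" by blast
  then show "y = (\<Sum>i<n. sc (f i y) (x i))" using biorthogonal_coeff[OF b, of _ c] by simp
next
  assume "y = (\<Sum>i<n. sc (f i y) (x i))"
  also have "\<dots> \<in> span (x ` {..<n})" by (intro span_sum span_scale span_base) auto
  finally show "y \<in> span (x ` {..<n})" .
qed

text \<open>
  The span is the fixed-point set of the continuous projection \<open>y \<mapsto> (\<Sum>i<n. sc (f i y) (x i))\<close>.
\<close>

lemma closed_biorthogonal_span:
  assumes b: "biorthogonal n x f"
  shows "closed (span (x ` {..<n}))"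
proof -
  have "span (x ` {..<n}) = {y. y = (\<Sum>i<n. sc (f i y) (x i))}"
    using biorthogonal_span_iff[OF b] by blast
  moreover have "continuous_on UNIV (\<lambda>y. \<Sum>i<n. sc (f i y) (x i))"
    using b unfolding biorthogonal_def
    by (intro continuous_on_sum linear_continuous_on bounded_linear_rank_one) auto
  ultimately show ?thesis by (simp add: closed_Collect_eq)
qed

text \<open>
  Subtract from \<open>d\<close> its projection to the old span, so that the old functionals vanish on the
  result \<open>z\<close>. Then correct any functional that does not vanish at \<open>z\<close> by the old ones and
  normalise it. The earlier members stay as they are, so the construction can be iterated forever.
\<close>

lemma biorthogonal_extend:
  assumes b: "biorthogonal n x f" and sep: "\<And>z. z \<noteq> 0 \<Longrightarrow> \<exists>g. functional g \<and> g z \<noteq> 0"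
    and d: "d \<notin> span (x ` {..<n})"
  shows "\<exists>z g. biorthogonal (Suc n) (x(n := z)) (f(n := g)) \<and> d - z \<in> span (x ` {..<n})"
proof -
  have f: "functional (f i)" if "i < n" for i using b that by (auto simp: biorthogonal_def)
  define z where "z = d - (\<Sum>i<n. sc (f i d) (x i))"
  have "z \<noteq> 0" using biorthogonal_span_iff[OF b, of d] d by (auto simp: z_def)
  then obtain h where h: "functional h" "h z \<noteq> 0" using sep by blast
  have fz: "f i z = 0" if "i < n" for i
    using biorthogonal_coeff[OF b that, of "\<lambda>i. f i d"] by (simp add: z_def functional_diff[OF f[OF that]])
  define g where "g y = (h y - (\<Sum>i<n. h (x i) * f i y)) / h z" for y
  have "functional g"
    unfolding functional_def
  proof
    show "bounded_linear g"
      using h f unfolding g_def functional_def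
      by (intro bounded_linear_divide[THEN bounded_linear_compose] bounded_linear_sub bounded_linear_sum
          bounded_linear_const_mult) auto
    show "\<forall>c x. g (sc c x) = c * g x"
      by (simp add: g_def functional_scale[OF h(1)] functional_scale[OF f] sum_distrib_left
          right_diff_distrib mult.left_commute)
  qed
  moreover have "g z = 1" using h(2) fz by (simp add: g_def)
  moreover have "g (x j) = 0" if "j < n" for j
  proof -
    have "(\<Sum>i<n. h (x i) * f i (x j)) = (\<Sum>i<n. if i = j then h (x i) else 0)"
      using b that unfolding biorthogonal_def by (intro sum.cong) auto
    then show ?thesis using that by (simp add: g_def)
  qed
  ultimately have "biorthogonal (Suc n) (x(n := z)) (f(n := g))"
    using b fz unfolding biorthogonal_def by (auto simp: less_Suc_eq)
  moreover have "d - z \<in> span (x ` {..<n})"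
    unfolding z_def by (simp, intro span_sum span_scale span_base) auto
  ultimately show ?thesis by blast
qed

text \<open>
  Extend step by step by the first member of a dense sequence that is not yet in the span. There is
  always one: otherwise the span, being closed, would be the whole space.
\<close>

lemma exists_biorthogonal_system:
  assumes sep: "\<And>z. z \<noteq> 0 \<Longrightarrow> \<exists>g. functional g \<and> g z \<noteq> 0"
    and separable: "separable_space (euclidean :: 'a topology)"
    and inf: "infinite_dimensional sc (UNIV :: 'a set)"
  shows "\<exists>x f. (\<forall>n. biorthogonal n x f) \<and> closure (span (range x)) = UNIV"
proof -
  obtain d :: "nat \<Rightarrow> 'a" where d: "closure (range d) = UNIV"
    using separable_space_dense_sequence[OF separable] by blast
  \<comment> \<open>The state at stage \<open>n\<close> is a pair of infinite sequences of which only the first \<open>n\<close> terms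
    matter; \<open>Q\<close> says that these are kept.\<close>
  define P where "P n s \<longleftrightarrow> biorthogonal n (fst s) (snd s) \<and> d ` {..<n} \<subseteq> span (fst s ` {..<n})" for n s
  define Q where "Q n s s' \<longleftrightarrow> (\<forall>i<n. fst s' i = fst s i \<and> snd s' i = snd s i)"
    for n and s s' :: "(nat \<Rightarrow> 'a) \<times> (nat \<Rightarrow> 'a \<Rightarrow> 'k)"
  have "\<exists>s. \<forall>n. P n (s n) \<and> Q n (s n) (s (Suc n))"
  proof (rule dependent_nat_choice)
    show "\<exists>s. P 0 s" by (simp add: P_def biorthogonal_def)
    fix s n assume s: "P n s"
    obtain x f where s_eq: "s = (x, f)" by (cases s)
    have b: "biorthogonal n x f" and dn: "d ` {..<n} \<subseteq> span (x ` {..<n})"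
      using s by (simp_all add: P_def s_eq)
    have "\<exists>k. d k \<notin> span (x ` {..<n})"
    proof (rule ccontr)
      assume "\<not> ?thesis"
      then have "range d \<subseteq> span (x ` {..<n})" by blast
      then have "UNIV \<subseteq> span (x ` {..<n})"
        using closure_minimal[OF _ closed_biorthogonal_span[OF b]] d by auto
      then show False using inf unfolding infinite_dimensional_def by blast
    qed
    then obtain k where k: "d k \<notin> span (x ` {..<n})" and least: "\<And>j. j < k \<Longrightarrow> d j \<in> span (x ` {..<n})"
      using exists_least_iff[of "\<lambda>k. d k \<notin> span (x ` {..<n})"] by blast
    \<comment> \<open>The least missing index is at least \<open>n\<close>, so adding \<open>d k\<close> also takes care of \<open>d n\<close>.\<close>
    have "n \<le> k" using dn k by (meson image_subset_iff lessThan_iff not_le)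
    obtain z g where z: "biorthogonal (Suc n) (x(n := z)) (f(n := g))" "d k - z \<in> span (x ` {..<n})"
      using biorthogonal_extend[OF b sep k] by blast
    have image: "(x(n := z)) ` {..<Suc n} = insert z (x ` {..<n})"
      by (auto simp: lessThan_Suc)
    have mono: "span (x ` {..<n}) \<subseteq> span (insert z (x ` {..<n}))" by (rule span_mono) auto
    have "d k - z + z \<in> span (insert z (x ` {..<n}))"
      using mono z(2) by (intro span_add span_base[of z]) auto
    then have "d j \<in> span (insert z (x ` {..<n}))" if "j \<le> k" for j
      using mono least[of j] that by (cases "j = k") auto
    then have "d ` {..<Suc n} \<subseteq> span ((x(n := z)) ` {..<Suc n})"
      unfolding image using \<open>n \<le> k\<close> by auto
    then show "\<exists>s'. P (Suc n) s' \<and> Q n s s'"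
      using z(1) by (intro exI[of _ "(x(n := z), f(n := g))"]) (auto simp: P_def Q_def s_eq)
  qed
  then obtain s where P: "\<And>n. P n (s n)" and Q: "\<And>n. Q n (s n) (s (Suc n))" by blast
  \<comment> \<open>the diagonal, where each term has just been fixed\<close>
  define x f where "x i = fst (s (Suc i)) i" and "f i = snd (s (Suc i)) i" for i
  have stable: "fst (s n) i = x i \<and> snd (s n) i = f i" if "i < n" for i n
  proof -
    from that have "Suc i \<le> n" by simp
    then show ?thesis
    proof (induction n rule: dec_induct)
      case (step n)
      then show ?case using Q[of n] by (simp add: Q_def)
    qed (simp add: x_def f_def)
  qed
  have "biorthogonal n x f" for n
    using P[of n] stable by (auto simp: P_def biorthogonal_def)
  moreover have "range d \<subseteq> span (range x)"
  proof safe
    fix n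
    have "d n \<in> span (fst (s (Suc n)) ` {..<Suc n})" using P[of "Suc n"] by (auto simp: P_def)
    also have "fst (s (Suc n)) ` {..<Suc n} = x ` {..<Suc n}"
      using stable by (intro image_cong) auto
    finally show "d n \<in> span (range x)" using span_mono[of "x ` {..<Suc n}" "range x"] by auto
  qed
  then have "closure (span (range x)) = UNIV" using closure_mono d by blast
  ultimately show ?thesis by blast
qed

lemma span_range_eq_Union: "span (range (x :: nat \<Rightarrow> 'a)) = (\<Union>n. span (x ` {..<n}))"
proof
  show "span (range x) \<subseteq> (\<Union>n. span (x ` {..<n}))"
  proof (rule span_minimal)
    show "subspace (\<Union>n. span (x ` {..<n}))"
    proof (rule subspaceI)
      fix a b assume "a \<in> (\<Union>n. span (x ` {..<n}))" "b \<in> (\<Union>n. span (x ` {..<n}))"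
      then obtain m n where "a \<in> span (x ` {..<m})" "b \<in> span (x ` {..<n})" by blast
      then have "a \<in> span (x ` {..<max m n})" "b \<in> span (x ` {..<max m n})"
        using span_mono[OF image_mono, of "{..<m}" "{..<max m n}" x]
          span_mono[OF image_mono, of "{..<n}" "{..<max m n}" x] by auto
      then show "a + b \<in> (\<Union>n. span (x ` {..<n}))" using span_add by blast
    qed (auto intro: span_zero span_scale)
    have "x n \<in> span (x ` {..<Suc n})" for n by (intro span_base) auto
    then show "range x \<subseteq> (\<Union>n. span (x ` {..<n}))" by blast
  qed
  show "(\<Union>n. span (x ` {..<n})) \<subseteq> span (range x)"
    by (intro UN_least span_mono) auto
qed

end

lemma exists_real_functional:
  assumes "z \<noteq> 0"
  shows "\<exists>g. normed_space_over.functional (scaleR :: real \<Rightarrow> 'a::real_normed_vector \<Rightarrow> 'a) g \<and> g z \<noteq> 0"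
  using exists_separating_functional[OF assms]
  by (auto simp: normed_space_over.functional_def[OF normed_space_over_scaleR] linear_scale bounded_linear.linear)

text \<open>
  A real functional \<open>h\<close> is the real part of the complex one \<open>y \<mapsto> h y - \<i> h (\<i> y)\<close>.
\<close>

lemma exists_complex_functional:
  assumes nso: "normed_space_over (sc :: complex \<Rightarrow> 'a::real_normed_vector \<Rightarrow> 'a)" and z: "z \<noteq> 0"
  shows "\<exists>g. normed_space_over.functional sc g \<and> g z \<noteq> 0"
proof -
  interpret normed_space_over sc by (rule nso)
  obtain h where h: "bounded_linear h" "h z \<noteq> (0 :: real)"
    using exists_separating_functional[OF z] by blast
  note [simp] = linear_add[OF bounded_linear.linear[OF h(1)]] linear_scale[OF bounded_linear.linear[OF h(1)]]
  define g where "g y = complex_of_real (h y) - \<i> * complex_of_real (h (sc \<i> y))" for y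
  have "bounded_linear g"
    unfolding g_def
    by (intro bounded_linear_sub bounded_linear_const_mult bounded_linear_compose[OF bounded_linear_of_real]
        bounded_linear_compose[OF h(1)] bounded_linear_scale bounded_linear_ident h(1))
  moreover have "g (sc c y) = c * g y" for c y
  proof -
    have "c = of_real (Re c) + of_real (Im c) * \<i>" by (simp add: complex_eq_iff)
    then have "sc c y = sc (of_real (Re c)) y + sc (of_real (Im c)) (sc \<i> y)"
      by (metis scale_left_distrib scale_scale)
    then have c: "sc c y = Re c *\<^sub>R y + Im c *\<^sub>R sc \<i> y" by (simp only: scale_of_real)
    have "\<i> * c = of_real (Re c) * \<i> + of_real (- Im c)" by (simp add: complex_eq_iff)
    then have "sc \<i> (sc c y) = sc (of_real (Re c)) (sc \<i> y) + sc (of_real (- Im c)) y"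
      by (metis scale_left_distrib scale_scale)
    then have ic: "sc \<i> (sc c y) = Re c *\<^sub>R sc \<i> y + (- Im c) *\<^sub>R y" by (simp only: scale_of_real)
    have "h (sc c y) = Re c * h y + Im c * h (sc \<i> y)" unfolding c by simp
    moreover have "h (sc \<i> (sc c y)) = Re c * h (sc \<i> y) - Im c * h y" unfolding ic
      by (simp add: linear_diff[OF bounded_linear.linear[OF h(1)]])
    ultimately show ?thesis by (simp add: g_def complex_eq_iff algebra_simps)
  qed
  moreover have "g z \<noteq> 0" using h(2) by (simp add: g_def complex_eq_iff)
  ultimately show ?thesis unfolding functional_def by blast
qed

section \<open>A closed subspace of supercyclic operators\<close>

text \<open>
  The sets \<open>{v k, ..., v (k + m - 1)}\<close> are independent with \<open>m\<close> elements, by adding one vector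
  at a time at the front, so no finite set spans all of them.
\<close>

lemma (in vector_space) not_finite_dimensional_if_triangular:
  assumes v: "\<And>k :: nat. v k \<notin> span (v ` {k<..})" and V: "range v \<subseteq> V"
  shows "infinite_dimensional scale V"
  unfolding infinite_dimensional_def
proof safe
  fix B assume B: "finite B" "V \<subseteq> span B"
  have "independent (v ` {k..<k + m}) \<and> card (v ` {k..<k + m}) = m" for k m
  proof (induction m arbitrary: k)
    case (Suc m)
    have eq: "v ` {k..<k + Suc m} = insert (v k) (v ` {Suc k..<Suc k + m})"
    proof -
      have "{k..<k + Suc m} = insert k {Suc k..<Suc k + m}" by auto
      then show ?thesis by simp
    qed
    have "v ` {Suc k..<Suc k + m} \<subseteq> v ` {k<..}" by auto
    then have notin: "v k \<notin> span (v ` {Suc k..<Suc k + m})"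
      using v[of k] span_mono by blast
    then have "v k \<notin> v ` {Suc k..<Suc k + m}" using span_base by blast
    then show ?case
      unfolding eq using Suc.IH[of "Suc k"] notin by (simp add: independent_insertI)
  qed (simp add: independent_empty)
  then have "independent (v ` {0..<Suc (card B)})" "card (v ` {0..<Suc (card B)}) = Suc (card B)"
    by (metis add_0)+
  moreover have "v ` {0..<Suc (card B)} \<subseteq> span B" using V B(2) by blast
  ultimately show False using independent_span_bound[OF B(1)] by (metis Suc_n_not_le_n)
qed

text \<open>
  The operator is the series of the rank one operators \<open>y \<mapsto> f (n + 1) y * x n\<close>, with weights \<open>w n\<close>
  small enough for absolute convergence. The last conclusion, which concerns all vectors \<open>y\<close>,
  identifies the kernel of the operator inside the span of the \<open>x n\<close>.
\<close>

lemma exists_weighted_shift: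
  fixes sc :: "'k::real_normed_field \<Rightarrow> 'a::banach \<Rightarrow> 'a"
  assumes nso: "normed_space_over sc" and b: "\<And>n. normed_space_over.biorthogonal sc n x f"
  shows "\<exists>T\<in>operators sc. \<exists>w. (\<forall>n. w n \<noteq> 0) \<and> blinfun_apply T (x 0) = 0 \<and>
     (\<forall>n. blinfun_apply T (x (Suc n)) = w n *\<^sub>R x n) \<and>
     (\<forall>n y. f n (blinfun_apply T y) = w n *\<^sub>R f (Suc n) y)"
proof -
  interpret normed_space_over sc by (rule nso)
  have f: "functional (f n)" for n using b[of "Suc n"] by (auto simp: biorthogonal_def)
  have fx: "f i (x j) = (if i = j then 1 else 0)" for i j
    using b[of "Suc (max i j)"] by (auto simp: biorthogonal_def)
  define R where "R n = Blinfun (\<lambda>y. sc (f (Suc n) y) (x n))" for n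
  have R: "blinfun_apply (R n) y = sc (f (Suc n) y) (x n)" for n y
    unfolding R_def by (simp add: bounded_linear_Blinfun_apply bounded_linear_rank_one[OF f])
  define w :: "nat \<Rightarrow> real" where "w n = (1 / 2) ^ n / (1 + norm (R n))" for n
  have den: "1 + norm (R n) > 0" for n by (simp add: add_pos_nonneg)
  then have w: "w n > 0" for n by (simp add: w_def)
  have "norm (w n *\<^sub>R R n) \<le> (1 / 2) ^ n" for n
  proof -
    have "norm (w n *\<^sub>R R n) = (1 / 2) ^ n * (norm (R n) / (1 + norm (R n)))"
      using w[of n] by (simp add: w_def)
    also have "\<dots> \<le> (1 / 2) ^ n * 1" using den by (intro mult_left_mono) simp_all
    finally show ?thesis by simp
  qed
  then have "summable (\<lambda>n. norm (w n *\<^sub>R R n))"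
    by (intro summable_comparison_test'[OF summable_geometric[of "1 / 2 :: real"], of 0]) simp_all
  then have sums: "(\<lambda>n. w n *\<^sub>R R n) sums (\<Sum>n. w n *\<^sub>R R n)"
    by (rule summable_sums[OF summable_norm_cancel])
  define T where "T = (\<Sum>n. w n *\<^sub>R R n)"
  have T: "(\<lambda>n. w n *\<^sub>R sc (f (Suc n) y) (x n)) sums blinfun_apply T y" for y
    using bounded_linear.sums[OF blinfun.bounded_linear_left[of y] sums]
    by (simp add: T_def scaleR_blinfun.rep_eq R)
  have "blinfun_apply T (sc c y) = sc c (blinfun_apply T y)" for c y
  proof (rule sums_unique2[OF T])
    have "sc c (w n *\<^sub>R sc (f (Suc n) y) (x n)) = w n *\<^sub>R sc (f (Suc n) (sc c y)) (x n)" for n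
      by (simp add: functional_scale[OF f] mult_ac flip: scale_of_real)
    then show "(\<lambda>n. w n *\<^sub>R sc (f (Suc n) (sc c y)) (x n)) sums sc c (blinfun_apply T y)"
      using bounded_linear.sums[OF bounded_linear_scale T[of y], of c] by simp
  qed
  then have "T \<in> operators sc"
    by (simp add: operators_def Vector_Spaces.linear_iff blinfun.add_right vector_space_axioms)
  moreover have "blinfun_apply T (x 0) = 0"
    using sums_unique2[OF T[of "x 0"]] by (simp add: fx)
  moreover have "blinfun_apply T (x (Suc m)) = w m *\<^sub>R x m" for m
  proof (rule sums_unique2[OF T])
    have "w n *\<^sub>R sc (f (Suc n) (x (Suc m))) (x n) = (if n = m then w n *\<^sub>R x n else 0)" for n
      by (simp add: fx)
    then show "(\<lambda>n. w n *\<^sub>R sc (f (Suc n) (x (Suc m))) (x n)) sums (w m *\<^sub>R x m)"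
      using sums_single[of m "\<lambda>n. w n *\<^sub>R x n"] by simp
  qed
  moreover have "f m (blinfun_apply T y) = w m *\<^sub>R f (Suc m) y" for m y
  proof -
    have "bounded_linear (f m)" using f by (simp add: functional_def)
    then have "(\<lambda>n. f m (w n *\<^sub>R sc (f (Suc n) y) (x n))) sums f m (blinfun_apply T y)"
      by (rule bounded_linear.sums[OF _ T])
    moreover have "f m (w n *\<^sub>R sc (f (Suc n) y) (x n)) = (if n = m then w n *\<^sub>R f (Suc n) y else 0)" for n
      by (simp add: functional_scale[OF f] fx scaleR_conv_of_real flip: scale_of_real)
    ultimately show ?thesis
      using sums_single[of m "\<lambda>n. w n *\<^sub>R f (Suc n) y"] sums_unique2 by simp
  qed
  ultimately show ?thesis using w by (metis less_irrefl)
qed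

definition blinfun_power :: "('a::real_normed_vector \<Rightarrow>\<^sub>L 'a) \<Rightarrow> nat \<Rightarrow> 'a \<Rightarrow>\<^sub>L 'a" where
  "blinfun_power T n = ((o\<^sub>L) T ^^ n) id_blinfun"

lemma blinfun_power_apply [simp]: "blinfun_apply (blinfun_power T n) x = (blinfun_apply T ^^ n) x"
  by (induction n) (simp_all add: blinfun_power_def)

text \<open>
  The subspace consists of the operators that commute with the weighted shift \<open>T\<close>, annihilate
  \<open>x 0\<close>, and map \<open>x n\<close> into the span of \<open>x 0, ..., x n\<close>. The last condition makes the linear span
  of all \<open>x n\<close> invariant and defines a closed set of operators, because the spans of finitely many
  \<open>x i\<close> are closed. The positive powers of \<open>T\<close> witness the infinite dimension.
\<close>

lemma spaceable_supercyclic: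
  fixes sc :: "'k::real_normed_field \<Rightarrow> 'a::banach \<Rightarrow> 'a"
  assumes nso: "normed_space_over sc" and separable: "separable_space (euclidean :: 'a topology)"
    and inf: "infinite_dimensional sc (UNIV :: 'a set)"
    and sep: "\<And>z. z \<noteq> 0 \<Longrightarrow> \<exists>g. normed_space_over.functional sc g \<and> g z \<noteq> 0"
  shows "spaceable (scale_op sc) {T. supercyclic sc T}"
proof -
  interpret normed_space_over sc by (rule nso)
  interpret op: normed_space_over "scale_op sc" by (rule normed_space_over_scale_op)
  obtain x f where b: "\<And>n. biorthogonal n x f" and dense: "closure (span (range x)) = UNIV"
    using exists_biorthogonal_system[OF sep separable inf] by blast
  have f: "functional (f n)" for n using b[of "Suc n"] by (auto simp: biorthogonal_def)
  have fx: "f i (x j) = (if i = j then 1 else 0)" for i j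
    using b[of "Suc (max i j)"] by (auto simp: biorthogonal_def)
  have x_nz: "x n \<noteq> 0" for n using fx[of n n] functional_zero[OF f, of n] by auto
  obtain T w where T: "T \<in> operators sc" and w: "\<And>n. w n \<noteq> (0 :: real)"
    and Tx0: "blinfun_apply T (x 0) = 0" and TxS: "\<And>n. blinfun_apply T (x (Suc n)) = w n *\<^sub>R x n"
    and fT: "\<And>n y. f n (blinfun_apply T y) = w n *\<^sub>R f (Suc n) y"
    using exists_weighted_shift[OF nso b] by blast
  let ?T = "blinfun_apply T"
  define F where "F n = span (x ` {..<n})" for n
  define E where "E = span (range x)"
  have E_eq: "E = (\<Union>n. F n)" unfolding E_def F_def by (rule span_range_eq_Union)
  have sub_F: "subspace (F n)" for n by (simp add: F_def subspace_span)
  have xF: "x i \<in> F n" if "i < n" for i n using that unfolding F_def by (intro span_base) auto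
  have scaleR_F: "r *\<^sub>R y \<in> F n" if "y \<in> F n" for r y n
    using subspace_scale[OF sub_F that, of "of_real r"] by (simp add: scale_of_real)
  have T_scale: "?T (sc c y) = sc c (?T y)" for c y by (rule operators_linear[OF T])
  have "F (Suc n) \<subseteq> {y. ?T y \<in> F n}" for n
    unfolding F_def[of "Suc n"]
  proof (rule span_minimal)
    show "subspace {y. ?T y \<in> F n}"
      using sub_F[of n]
      by (auto simp: subspace_def blinfun.add_right blinfun.zero_right T_scale)
    have "?T (x i) \<in> F n" if "i < Suc n" for i
      using that Tx0 TxS subspace_0[OF sub_F] by (cases i) (auto intro!: scaleR_F xF)
    then show "x ` {..<Suc n} \<subseteq> {y. ?T y \<in> F n}" by auto
  qed
  then have TF: "?T y \<in> F n" if "y \<in> F (Suc n)" for y n using that by auto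
  have F_mono: "F m \<subseteq> F n" if "m \<le> n" for m n
    using that unfolding F_def by (intro span_mono image_mono) auto
  have TF': "?T y \<in> F n" if "y \<in> F n" for y n
  proof (cases n)
    case 0
    then show ?thesis using that TF[of y 0] F_mono[of 0 "Suc 0"] by auto
  next
    case (Suc m)
    then show ?thesis using that TF[of y m] F_mono[of m n] by auto
  qed
  have pow_F: "(?T ^^ k) y \<in> F n" if "y \<in> F n" for k y n
    using that by (induction k) (auto intro: TF')
  have pow_zero: "(?T ^^ n) y = 0" if "y \<in> F n" for n y
    using that
  proof (induction n arbitrary: y)
    case 0
    then show ?case by (simp add: F_def)
  next
    case (Suc n)
    then show ?case using TF[of y n] by (simp add: funpow_swap1)
  qed
  \<comment> \<open>The power \<open>T\<^sup>n\<close> does not annihilate \<open>x n\<close>, but all higher powers do.\<close>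
  have pow_x: "\<exists>c\<noteq>0. (?T ^^ n) (x n) = c *\<^sub>R x 0" for n
  proof (induction n)
    case 0
    show ?case by (intro exI[of _ 1]) simp
  next
    case (Suc n)
    then obtain c where c: "c \<noteq> 0" "(?T ^^ n) (x n) = c *\<^sub>R x 0" by blast
    have "(?T ^^ Suc n) (x (Suc n)) = (?T ^^ n) (sc (of_real (w n)) (x n))"
      by (simp only: funpow_Suc_right o_apply TxS scale_of_real)
    also have "\<dots> = sc (of_real (w n)) (c *\<^sub>R x 0)"
      by (simp only: funpow_operator_scale[OF T] c)
    also have "\<dots> = w n *\<^sub>R c *\<^sub>R x 0" by (rule scale_of_real)
    finally show ?case using w[of n] c(1) by (intro exI[of _ "w n * c"]) simp
  qed
  define V where "V = {A \<in> operators sc. blinfun_apply A (x 0) = 0 \<and>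
      (\<forall>y. blinfun_apply A (?T y) = ?T (blinfun_apply A y)) \<and>
      (\<forall>n. blinfun_apply A (x n) \<in> F (Suc n))}"
  have "op.subspace V"
  proof (rule op.subspaceI)
    show "0 \<in> V"
      using subspace_0[OF sub_F]
      by (auto simp: V_def operators_def Vector_Spaces.linear_iff blinfun.zero_left blinfun.zero_right
          vector_space_axioms)
    show "A + B \<in> V" if "A \<in> V" "B \<in> V" for A B
      using that subspace_add[OF sub_F]
      by (auto simp: V_def operators_def Vector_Spaces.linear_iff blinfun.bilinear_simps
          vector_space_axioms scale_right_distrib)
    show "scale_op sc c A \<in> V" if "A \<in> V" for c A
      using that subspace_scale[OF sub_F]
      by (auto simp: V_def operators_def Vector_Spaces.linear_iff blinfun.bilinear_simps
          vector_space_axioms scale_right_distrib T_scale mult.commute)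
  qed
  moreover have "closed V"
  proof -
    have "closed {A. blinfun_apply A (x n) \<in> F (Suc n)}" for n
    proof -
      have "closed ((\<lambda>A. blinfun_apply A (x n)) -` F (Suc n))"
        unfolding F_def
        by (intro continuous_closed_vimage closed_biorthogonal_span[OF b]
            linear_continuous_at blinfun.bounded_linear_left)
      then show ?thesis by (simp add: vimage_def)
    qed
    then show ?thesis
      unfolding V_def Collect_conj_eq Collect_all_eq Collect_mem_eq
      by (intro closed_Int closed_INT ballI closed_operators closed_Collect_eq continuous_intros)
  qed
  moreover have "infinite_dimensional (scale_op sc) V"
  proof (rule op.not_finite_dimensional_if_triangular)
    show "range (\<lambda>k. blinfun_power T (Suc k)) \<subseteq> V"
    proof safe
      fix k
      have "blinfun_power T (Suc k) \<in> operators sc"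
        by (simp del: funpow.simps add: operators_def Vector_Spaces.linear_iff vector_space_axioms
            blinfun.add_right funpow_operator_scale[OF T])
      moreover have "(?T ^^ Suc k) (x 0) = 0"
        by (simp only: funpow_Suc_right o_apply Tx0 funpow_operator_zero[OF T])
      moreover have "(?T ^^ Suc k) (?T y) = ?T ((?T ^^ Suc k) y)" for y
        by (simp add: funpow_swap1)
      moreover have "(?T ^^ Suc k) (x n) \<in> F (Suc n)" for n
        by (intro pow_F xF) simp
      ultimately show "blinfun_power T (Suc k) \<in> V"
        unfolding V_def by (simp del: funpow.simps)
    qed
    fix k
    let ?S = "(\<lambda>k. blinfun_power T (Suc k)) ` {k<..}"
    have "op.span ?S \<subseteq> {A. blinfun_apply A (x (Suc k)) = 0}"
    proof (rule op.span_minimal)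
      have "(?T ^^ Suc j) (x (Suc k)) = 0" if "k < j" for j
        using that by (intro pow_zero xF) simp
      then show "?S \<subseteq> {A. blinfun_apply A (x (Suc k)) = 0}" by (auto simp del: funpow.simps)
      show "op.subspace {A. blinfun_apply A (x (Suc k)) = 0}"
        by (auto simp: op.subspace_def blinfun.bilinear_simps)
    qed
    moreover have "blinfun_apply (blinfun_power T (Suc k)) (x (Suc k)) \<noteq> 0"
      using pow_x[of "Suc k"] x_nz[of 0] by (auto simp del: funpow.simps)
    ultimately show "blinfun_power T (Suc k) \<notin> op.span ?S" by blast
  qed
  moreover have "supercyclic sc A" if A: "A \<in> V" "A \<noteq> 0" for A
  proof (rule supercyclic_if_commutes_with_shift[OF nso separable T _ _ _ _ _ _ _ _ _ A(2), where E = E and e = "x 0"])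
    show A_op: "A \<in> operators sc" using A by (simp add: V_def)
    show E: "subspace E" by (simp add: E_def subspace_span)
    show "closure E = UNIV" using dense by (simp add: E_def)
    show "\<exists>n. (?T ^^ n) y = 0" if "y \<in> E" for y using that pow_zero by (auto simp: E_eq)
    show "?T ` E = E"
    proof
      show "?T ` E \<subseteq> E" using TF' by (auto simp: E_eq)
      have "subspace (?T ` E)"
        using E by (auto simp: subspace_def image_iff T_scale[symmetric] blinfun.add_right[symmetric])
           (metis blinfun.zero_right)
      moreover have "x n \<in> ?T ` E" for n
      proof -
        have "x n = ?T ((1 / w n) *\<^sub>R x (Suc n))"
          using w[of n] by (simp add: blinfun.scaleR_right TxS)
        moreover have "(1 / w n) *\<^sub>R x (Suc n) \<in> E" unfolding E_eq by (blast intro: scaleR_F xF)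
        ultimately show ?thesis by blast
      qed
      ultimately show "E \<subseteq> ?T ` E" unfolding E_def by (intro span_minimal) (auto simp: E_def)
    qed
    show "\<exists>c. y = sc c (x 0)" if "y \<in> E" "?T y = 0" for y
    proof -
      have fS: "f (Suc n) y = 0" for n using fT[of n y] that(2) w[of n] functional_zero[OF f] by simp
      obtain n where "y \<in> F n" using \<open>y \<in> E\<close> by (auto simp: E_eq)
      then have "y \<in> F (Suc n)" using F_mono[of n "Suc n"] by auto
      then have "y = (\<Sum>i<Suc n. sc (f i y) (x i))"
        using biorthogonal_span_iff[OF b] by (simp only: F_def)
      also have "\<dots> = sc (f 0 y) (x 0)" by (subst sum.lessThan_Suc_shift) (simp add: fS)
      finally show ?thesis ..
    qed
    show "blinfun_apply A (?T y) = ?T (blinfun_apply A y)" for y using A by (simp add: V_def)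
    show "blinfun_apply A (x 0) = 0" using A by (simp add: V_def)
    have "E \<subseteq> {y. blinfun_apply A y \<in> span (range x)}"
      unfolding E_def
    proof (rule span_minimal)
      show "range x \<subseteq> {y. blinfun_apply A y \<in> span (range x)}"
        using A by (auto simp: V_def E_eq E_def[symmetric])
      show "subspace {y. blinfun_apply A y \<in> span (range x)}"
        by (auto simp: subspace_def blinfun.bilinear_simps operators_linear[OF A_op]
            intro: span_zero span_add span_scale)
    qed
    then show "blinfun_apply A ` E \<subseteq> E" by (auto simp: E_def)
  qed
  ultimately show ?thesis unfolding spaceable_def by (intro exI[of _ V]) auto
qed

section \<open>Spaceability of the supercyclic operators\<close>

theorem theorem1p1:
  fixes scaleC :: "complex \<Rightarrow> 'b::banach \<Rightarrow> 'b"
  shows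
    "(separable_space (euclidean :: 'a::banach topology) \<and>
        infinite_dimensional scaleR (UNIV :: 'a set) \<longrightarrow>
        spaceable (scale_op scaleR) {T :: 'a \<Rightarrow>\<^sub>L 'a. supercyclic scaleR T}) \<and>
     (normed_space_over scaleC \<and>
        separable_space (euclidean :: 'b topology) \<and>
        infinite_dimensional scaleC (UNIV :: 'b set) \<longrightarrow>
        spaceable (scale_op scaleC) {T :: 'b \<Rightarrow>\<^sub>L 'b. supercyclic scaleC T}) \<and>
     (\<exists>J :: real ell1 \<Rightarrow> (real ell1 \<Rightarrow>\<^sub>L real ell1).
        Vector_Spaces.linear scale_ell1 (scale_op scale_ell1) J \<and>
        (\<forall>f. norm (J f) = norm f) \<and>
        (\<forall>f. f \<noteq> 0 \<longrightarrow> supercyclic scale_ell1 (J f))) \<and>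
     (\<exists>J :: complex ell1 \<Rightarrow> (complex ell1 \<Rightarrow>\<^sub>L complex ell1).
        Vector_Spaces.linear scale_ell1 (scale_op scale_ell1) J \<and>
        (\<forall>f. norm (J f) = norm f) \<and>
        (\<forall>f. f \<noteq> 0 \<longrightarrow> supercyclic scale_ell1 (J f)))"
proof (intro conjI impI)
  assume "separable_space (euclidean :: 'a topology) \<and> infinite_dimensional scaleR (UNIV :: 'a set)"
  then show "spaceable (scale_op scaleR) {T :: 'a \<Rightarrow>\<^sub>L 'a. supercyclic scaleR T}"
    by (intro spaceable_supercyclic normed_space_over_scaleR exists_real_functional) auto
next
  assume "normed_space_over scaleC \<and> separable_space (euclidean :: 'b topology) \<and>
    infinite_dimensional scaleC (UNIV :: 'b set)"
  then show "spaceable (scale_op scaleC) {T :: 'b \<Rightarrow>\<^sub>L 'b. supercyclic scaleC T}"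
    by (intro spaceable_supercyclic exists_complex_functional) auto
next
  show "\<exists>J :: real ell1 \<Rightarrow> (real ell1 \<Rightarrow>\<^sub>L real ell1).
        Vector_Spaces.linear scale_ell1 (scale_op scale_ell1) J \<and>
        (\<forall>f. norm (J f) = norm f) \<and>
        (\<forall>f. f \<noteq> 0 \<longrightarrow> supercyclic scale_ell1 (J f))"
    using linear_shift_series norm_shift_series supercyclic_shift_series by blast
next
  show "\<exists>J :: complex ell1 \<Rightarrow> (complex ell1 \<Rightarrow>\<^sub>L complex ell1).
        Vector_Spaces.linear scale_ell1 (scale_op scale_ell1) J \<and>
        (\<forall>f. norm (J f) = norm f) \<and>
        (\<forall>f. f \<noteq> 0 \<longrightarrow> supercyclic scale_ell1 (J f))"
    using linear_shift_series norm_shift_series supercyclic_shift_series by blast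
qed

end
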